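(* Let $\mathcal{M} = (M,\varphi)$ be an $F$-crystal over $k$ of rank $r$ with Hodge slopes $e_1, \dots, e_r$, and let $I = \{1,\dots,r\}$. Then there exist $g \in \mathrm{GL}_M(W(k))$ with $g \equiv \mathrm{id}_M$ modulo $p$, a $W(k)$-basis $\{v_1,\dots,v_r\}$ of $M$, and a permutation $\pi$ of $I$ such that, letting $\varphi_{\pi}: M \to M$ be the $\sigma$-linear monomorphism with $\varphi_{\pi}(v_i) = p^{e_i}v_{\pi(i)}$ for all $i \in I$, the $F$-crystal $\mathcal{M}$ is isomorphic to $(M, g\varphi_{\pi})$.
   Context: $k$ is an algebraically closed field of characteristic $p>0$, $W(k)$ its Witt vectors, $\sigma$ the Frobenius of $W(k)$. An $F$-crystal is a pair $(M,\varphi)$ with $M$ a free $W(k)$-module of finite rank and $\varphi: M\to M$ an injective $\sigma$-linear map. The Hodge slopes $e_1,\dots,e_r$ are the non-negative integers for which there exist $W(k)$-bases $\{u_i\}$, $\{w_i\}$ of $M$ with $\varphi(u_i)=p^{e_i}w_i$. *)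

theory Defs
  imports
    "HOL-Library.Poly_Mapping"
    "HOL-Computational_Algebra.Primes"
    "HOL-Computational_Algebra.Polynomial"
    "HOL-Combinatorics.Permutations"
begin

section \<open>Integer polynomials in arbitrarily many variables\<close>

type_synonym 'v mpoly_int = "('v \<Rightarrow>\<^sub>0 nat) \<Rightarrow>\<^sub>0 int"

definition mpvar :: "'v \<Rightarrow> 'v mpoly_int" where
  "mpvar v = Poly_Mapping.single (Poly_Mapping.single v 1) 1"

definition mono_eval :: "('v \<Rightarrow> 'a::comm_ring_1) \<Rightarrow> ('v \<Rightarrow>\<^sub>0 nat) \<Rightarrow> 'a" where
  "mono_eval f m = (\<Prod>v\<in>Poly_Mapping.keys m. f v ^ Poly_Mapping.lookup m v)"

definition mpeval :: "('v \<Rightarrow> 'a::comm_ring_1) \<Rightarrow> 'v mpoly_int \<Rightarrow> 'a" where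
  "mpeval f P = (\<Sum>m\<in>Poly_Mapping.keys P. of_int (Poly_Mapping.lookup P m) * mono_eval f m)"

lemma mono_eval_0 [simp]: "mono_eval f 0 = 1"
  by (simp add: mono_eval_def)

lemma mono_eval_superset:
  assumes "finite S" "Poly_Mapping.keys m \<subseteq> S"
  shows "mono_eval f m = (\<Prod>v\<in>S. f v ^ Poly_Mapping.lookup m v)"
  unfolding mono_eval_def
  by (rule prod.mono_neutral_left) (use assms in \<open>auto simp: in_keys_iff\<close>)

lemma mono_eval_add: "mono_eval f (m + n) = mono_eval f m * mono_eval f n"
proof -
  let ?S = "Poly_Mapping.keys m \<union> Poly_Mapping.keys n"
  have "mono_eval f (m + n) = (\<Prod>v\<in>?S. f v ^ Poly_Mapping.lookup (m + n) v)"
    by (rule mono_eval_superset) (auto dest: subsetD[OF Poly_Mapping.keys_add])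
  also have "\<dots> = mono_eval f m * mono_eval f n"
    by (simp add: mono_eval_superset[of ?S m] mono_eval_superset[of ?S n]
        lookup_add power_add prod.distrib)
  finally show ?thesis .
qed

lemma mpeval_0 [simp]: "mpeval f 0 = 0"
  by (simp add: mpeval_def)

lemma mpeval_single: "mpeval f (Poly_Mapping.single m c) = of_int c * mono_eval f m"
  by (simp add: mpeval_def)

lemma mpeval_1 [simp]: "mpeval f 1 = 1"
  by (simp add: mpeval_single flip: single_one)

lemma mpeval_mpvar [simp]: "mpeval f (mpvar v) = f v"
  by (simp add: mpvar_def mpeval_single mono_eval_def)

lemma mpeval_add: "mpeval f (P + Q) = mpeval f P + mpeval f Q"
  unfolding mpeval_def by (rule setsum_keys_plus_distrib) (simp_all add: ring_distribs)

lemma mpoly_int_induct [case_names zero add]: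
  assumes "P 0" "\<And>m c f. P f \<Longrightarrow> P (Poly_Mapping.single m c + f)"
  shows "P (f :: 'v mpoly_int)"
proof (induction f rule: update_induct)
  case (update f a b)
  have "Poly_Mapping.update a b f = Poly_Mapping.single a b + f"
    using update(1) by (intro poly_mapping_eqI)
      (auto simp: lookup_update lookup_add lookup_single in_keys_iff when_def)
  then show ?case using assms(2)[OF update(3)] by simp
qed (rule assms)

lemma mpeval_mult: "mpeval f (P * Q) = mpeval f P * mpeval f Q"
proof (induction P rule: mpoly_int_induct)
  case (add m c P)
  have "mpeval f (Poly_Mapping.single m c * Q) = mpeval f (Poly_Mapping.single m c) * mpeval f Q"
    by (induction Q rule: mpoly_int_induct)
       (simp_all add: mpeval_add mpeval_single mult_single mono_eval_add algebra_simps)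
  then show ?case using add by (simp add: mpeval_add algebra_simps)
qed simp

lemma mpeval_uminus: "mpeval f (- P) = - mpeval f P"
  using mpeval_add[of f P "- P"] by (simp add: eq_neg_iff_add_eq_0 add.commute)

lemma mpeval_diff: "mpeval f (P - Q) = mpeval f P - mpeval f Q"
  using mpeval_add[of f P "- Q"] by (simp add: mpeval_uminus)

lemma mpeval_power: "mpeval f (P ^ n) = mpeval f P ^ n"
  by (induction n) (simp_all add: mpeval_mult)

lemma mpeval_sum: "mpeval f (sum g A) = (\<Sum>x\<in>A. mpeval f (g x))"
  by (induction A rule: infinite_finite_induct) (simp_all add: mpeval_add)

lemma mpeval_prod: "mpeval f (prod g A) = (\<Prod>x\<in>A. mpeval f (g x))"
  by (induction A rule: infinite_finite_induct) (simp_all add: mpeval_mult)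

lemma mpeval_of_nat [simp]: "mpeval f (of_nat n) = of_nat n"
  by (induction n) (simp_all add: mpeval_add)

lemma mpoly_int_of_nat_mult_cancel:
  fixes P Q :: "'v mpoly_int"
  assumes "n > 0" "of_nat n * P = of_nat n * Q"
  shows "P = Q"
proof (rule poly_mapping_eqI)
  have *: "Poly_Mapping.lookup (of_nat n * R) k = int n * Poly_Mapping.lookup R k"
    for R :: "'v mpoly_int" and k
    by (induction n) (simp_all add: lookup_add algebra_simps)
  fix k show "Poly_Mapping.lookup P k = Poly_Mapping.lookup Q k"
    using arg_cong[OF assms(2), of "\<lambda>R. Poly_Mapping.lookup R k"] assms(1) by (simp add: *)
qed

lemma mpeval_comp: "mpeval f (mpeval g P) = mpeval (\<lambda>v. mpeval f (g v)) P"
proof (induction P rule: mpoly_int_induct)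
  case (add m c P)
  have "mpeval f (of_int c) = of_int c"
    by (cases c) (simp_all add: mpeval_uminus mpeval_diff)
  moreover have "mpeval f (mono_eval g m) = mono_eval (\<lambda>v. mpeval f (g v)) m"
    by (simp add: mono_eval_def mpeval_power mpeval_prod)
  ultimately show ?case using add by (simp add: mpeval_add mpeval_single mpeval_mult)
qed simp


section \<open>Witt polynomials\<close>

text \<open>The Witt polynomial \<open>w\<^sub>n = \<Sum>\<^sub>i p\<^sup>i X\<^sub>i^(p^(n-i))\<close> at \<open>x\<close>.\<close>

definition ghost :: "nat \<Rightarrow> (nat \<Rightarrow> 'a::comm_ring_1) \<Rightarrow> nat \<Rightarrow> 'a" where
  "ghost p x n = (\<Sum>i\<le>n. of_nat p ^ i * x i ^ (p ^ (n - i)))"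

text \<open>\<open>wvar j\<close> is the \<open>j\<close>-th universal vector of indeterminates.\<close>

abbreviation wvar :: "nat \<Rightarrow> nat \<Rightarrow> (nat \<times> nat) mpoly_int" where
  "wvar j i \<equiv> mpvar (j, i)"

text \<open>The polynomials \<open>S\<^sub>n\<close>, \<open>P\<^sub>n\<close> and \<open>N\<^sub>n\<close> giving addition, multiplication and negation of
  Witt vectors; existence and uniqueness are proved below.\<close>

definition witt_S :: "nat \<Rightarrow> nat \<Rightarrow> (nat \<times> nat) mpoly_int" where
  "witt_S p = (THE s. \<forall>n. ghost p s n = ghost p (wvar 0) n + ghost p (wvar 1) n)"

definition witt_P :: "nat \<Rightarrow> nat \<Rightarrow> (nat \<times> nat) mpoly_int" where
  "witt_P p = (THE s. \<forall>n. ghost p s n = ghost p (wvar 0) n * ghost p (wvar 1) n)"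

definition witt_N :: "nat \<Rightarrow> nat \<Rightarrow> (nat \<times> nat) mpoly_int" where
  "witt_N p = (THE s. \<forall>n. ghost p s n = - ghost p (wvar 0) n)"

lemma ghost_split:
  "ghost p x n = (\<Sum>i<n. of_nat p ^ i * x i ^ (p ^ (n - i))) + of_nat p ^ n * x n"
  unfolding ghost_def by (simp flip: lessThan_Suc_atMost)

lemma ghost_inj:
  fixes x y :: "nat \<Rightarrow> 'v mpoly_int"
  assumes "p > 0" "\<And>n. ghost p x n = ghost p y n"
  shows "x = y"
proof
  fix n show "x n = y n"
  proof (induction n rule: less_induct)
    case (less n)
    then have "(\<Sum>i<n. of_nat p ^ i * x i ^ (p ^ (n - i))) = (\<Sum>i<n. of_nat p ^ i * y i ^ (p ^ (n - i)))"
      by (intro sum.cong) auto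
    then have "of_nat (p ^ n) * x n = of_nat (p ^ n) * y n"
      using assms(2)[of n] by (simp add: ghost_split)
    with assms(1) show ?case by (rule mpoly_int_of_nat_mult_cancel[OF zero_less_power])
  qed
qed

lemma mpeval_ghost: "mpeval f (ghost p x n) = ghost p (\<lambda>i. mpeval f (x i)) n"
  by (simp add: ghost_def mpeval_sum mpeval_mult mpeval_power)

lemma prime_dvd_power_add:
  fixes a b :: "'a::comm_ring_1"
  assumes "prime p"
  shows "of_nat p dvd (a + b) ^ p - (a ^ p + b ^ p)"
proof -
  have p: "p > 0" using assms prime_gt_0_nat by blast
  have "(a + b) ^ p = (\<Sum>k\<le>p. of_nat (p choose k) * a ^ k * b ^ (p - k))"
    by (rule binomial_ring)
  also have "\<dots> = (\<Sum>k\<in>{0,p}. of_nat (p choose k) * a ^ k * b ^ (p - k))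
      + (\<Sum>k\<in>{..p} - {0,p}. of_nat (p choose k) * a ^ k * b ^ (p - k))"
    by (subst sum.subset_diff[of "{0,p}"]) auto
  also have "(\<Sum>k\<in>{0,p}. of_nat (p choose k) * a ^ k * b ^ (p - k)) = a ^ p + b ^ p"
    using p by (simp add: add.commute)
  finally have "(a + b) ^ p - (a ^ p + b ^ p)
      = (\<Sum>k\<in>{..p} - {0,p}. of_nat (p choose k) * a ^ k * b ^ (p - k))" by simp
  moreover have "of_nat p dvd (\<Sum>k\<in>{..p} - {0,p}. of_nat (p choose k) * a ^ k * b ^ (p - k))"
  proof (intro dvd_sum dvd_mult2)
    fix k assume "k \<in> {..p} - {0, p}"
    then have "p dvd (p choose k)" using assms p by (intro dvd_choose_prime) auto
    then show "of_nat p dvd (of_nat (p choose k) :: 'a)" by (auto elim!: dvdE)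
  qed
  ultimately show ?thesis by simp
qed

lemma dvd_power_p_diff:
  fixes a b :: "'a::comm_ring_1"
  assumes "prime p" "of_nat p ^ Suc m dvd a - b"
  shows "of_nat p ^ Suc (Suc m) dvd a ^ p - b ^ p"
proof -
  have "p > 0" using assms prime_gt_0_nat by blast
  obtain c where c: "a = b + of_nat p ^ Suc m * c"
    using assms(2) by (auto elim!: dvdE simp: algebra_simps)
  have "of_nat p dvd (\<Sum>i<p. a ^ (p - Suc i) * b ^ i)"
  proof -
    have "of_nat p dvd a ^ k - b ^ k" for k
    proof -
      have "of_nat p dvd a - b"
        using dvd_trans[OF dvd_triv_left assms(2)[unfolded power_Suc]] .
      moreover have "a - b dvd a ^ k - b ^ k"
        unfolding power_diff_sumr2[of a k b] by (rule dvd_triv_left)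
      ultimately show ?thesis by (rule dvd_trans)
    qed
    then have "of_nat p dvd (\<Sum>i<p. (a ^ (p - Suc i) - b ^ (p - Suc i)) * b ^ i)"
      by (intro dvd_sum dvd_mult2)
    moreover have "(\<Sum>i<p. b ^ (p - Suc i) * b ^ i) = of_nat p * b ^ (p - 1)"
      by (simp flip: power_add)
    ultimately have "of_nat p dvd (\<Sum>i<p. (a ^ (p - Suc i) - b ^ (p - Suc i)) * b ^ i)
        + (\<Sum>i<p. b ^ (p - Suc i) * b ^ i)" by (metis dvd_add dvd_triv_left)
    then show ?thesis by (simp add: algebra_simps sum_subtractf)
  qed
  moreover have "a ^ p - b ^ p = (a - b) * (\<Sum>i<p. a ^ (p - Suc i) * b ^ i)"
    using power_diff_sumr2[of b p a] by (simp add: algebra_simps)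
  ultimately show ?thesis
    using mult_dvd_mono[OF assms(2)] by (simp only: power_Suc2[of _ "Suc m"])
qed

lemma dvd_power_p_power_diff:
  fixes a b :: "'a::comm_ring_1"
  assumes "prime p" "of_nat p dvd a - b"
  shows "of_nat p ^ Suc m dvd a ^ (p ^ m) - b ^ (p ^ m)"
proof (induction m)
  case (Suc m)
  have "of_nat p ^ Suc (Suc m) dvd (a ^ (p ^ m)) ^ p - (b ^ (p ^ m)) ^ p"
    by (rule dvd_power_p_diff[OF assms(1) Suc])
  then show ?case by (simp add: mult.commute flip: power_mult)
qed (use assms in simp)

text \<open>The lift \<open>X\<^sub>v \<mapsto> X\<^sub>v\<^sup>p\<close> of the Frobenius endomorphism.\<close>

definition frob_lift :: "nat \<Rightarrow> 'v mpoly_int \<Rightarrow> 'v mpoly_int" where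
  "frob_lift p = mpeval (\<lambda>v. mpvar v ^ p)"

lemma mono_eval_mpvar: "mono_eval mpvar m = Poly_Mapping.single m 1"
proof (induction m rule: update_induct)
  case (update m a b)
  have up: "Poly_Mapping.update a b m = Poly_Mapping.single a b + m"
    using update(1) by (intro poly_mapping_eqI)
      (auto simp: lookup_update lookup_add lookup_single in_keys_iff when_def)
  have "mpvar a ^ n = Poly_Mapping.single (Poly_Mapping.single a n) (1::int)" for n
    by (induction n) (simp_all add: mpvar_def mult_single single_add[symmetric])
  then have "mono_eval mpvar (Poly_Mapping.single a b) = Poly_Mapping.single (Poly_Mapping.single a b) (1::int)"
    by (simp add: mono_eval_def)
  then show ?case using update(3) by (simp add: up mono_eval_add mult_single)
qed simp

lemma int_fermat:
  fixes c :: int assumes "prime p"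
  shows "int p dvd c ^ p - c"
proof -
  have p: "p > 0" using assms prime_gt_0_nat by blast
  have nat: "int p dvd int n ^ p - int n" for n
  proof (induction n)
    case (Suc n)
    have "int p dvd (int n + 1) ^ p - (int n ^ p + 1 ^ p)"
      using prime_dvd_power_add[OF assms, of "int n" 1] by simp
    from dvd_add[OF this Suc] show ?case by (simp add: algebra_simps)
  qed (use p in \<open>simp add: power_0_left\<close>)
  show ?thesis
  proof (cases "c \<ge> 0")
    case True
    then show ?thesis using nat[of "nat c"] by simp
  next
    case False
    have "int p dvd (c + - c) ^ p - (c ^ p + (- c) ^ p)"
      using prime_dvd_power_add[OF assms, of c "- c"] by simp
    moreover have "int p dvd (- c) ^ p - (- c)" using nat[of "nat (- c)"] False by simp
    ultimately have "int p dvd - (((c + - c) ^ p - (c ^ p + (- c) ^ p)) + ((- c) ^ p - (- c)))"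
      by (metis dvd_add dvd_minus_iff)
    then show ?thesis using p by (simp add: power_0_left)
  qed
qed

lemma frob_lift_cong: "prime p \<Longrightarrow> of_nat p dvd frob_lift p P - P ^ p"
proof (induction P rule: mpoly_int_induct)
  case zero
  then have "p > 0" using prime_gt_0_nat by blast
  then show ?case by (simp add: frob_lift_def power_0_left)
next
  case (add m c P)
  let ?s = "Poly_Mapping.single m c"
  let ?M = "mono_eval mpvar m :: 'a mpoly_int"
  have s: "?s = of_int c * ?M"
    by (simp add: mono_eval_mpvar mult_single flip: single_of_int)
  have "mono_eval (\<lambda>v. mpvar v ^ p) m = ?M ^ p"
    by (simp add: mono_eval_def prod_power_distrib mult.commute flip: power_mult)
  then have "frob_lift p ?s = of_int c * ?M ^ p"
    by (simp add: frob_lift_def mpeval_single)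
  then have "frob_lift p ?s - ?s ^ p = of_int (c - c ^ p) * ?M ^ p"
    by (simp add: s power_mult_distrib left_diff_distrib)
  moreover have "int p dvd c - c ^ p" using int_fermat[OF add.prems, of c] by (simp add: dvd_diff_commute)
  then obtain d where "c - c ^ p = int p * d" by (elim dvdE)
  ultimately have 1: "of_nat p dvd frob_lift p ?s - ?s ^ p"
    by (metis dvd_mult2 dvd_triv_left of_int_mult of_int_of_nat_eq)
  have "frob_lift p (?s + P) - (?s + P) ^ p =
     (frob_lift p ?s - ?s ^ p) + (frob_lift p P - P ^ p) - ((?s + P) ^ p - (?s ^ p + P ^ p))"
    by (simp add: frob_lift_def mpeval_add)
  then show ?case
    using 1 add.IH[OF add.prems] prime_dvd_power_add[OF add.prems, of ?s P] by (metis dvd_add dvd_diff)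
qed

text \<open>Dwork's criterion for a sequence to be the sequence of ghost components of some vector.\<close>

lemma dwork_exists:
  fixes G :: "nat \<Rightarrow> 'v mpoly_int"
  assumes p: "prime p" and G: "\<And>n. of_nat p ^ Suc n dvd G (Suc n) - frob_lift p (G n)"
  shows "\<exists>!s. \<forall>n. ghost p s n = G n"
proof -
  let ?Q = "\<lambda>s n r. (\<Sum>i<n. of_nat p ^ i * s i ^ (p ^ (n - i))) + of_nat p ^ n * r = G n"
  have "\<exists>s. \<forall>n. ?Q s n (s n)"
  proof (rule dependent_wellorder_choice)
    fix r and f g :: "nat \<Rightarrow> 'v mpoly_int" and n :: nat
    assume "\<And>m. m < n \<Longrightarrow> f m = g m"
    then have "(\<Sum>i<n. of_nat p ^ i * f i ^ (p ^ (n - i))) = (\<Sum>i<n. of_nat p ^ i * g i ^ (p ^ (n - i)))"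
      by (intro sum.cong) auto
    then show "?Q f n r = ?Q g n r" by simp
  next
    fix n and s :: "nat \<Rightarrow> 'v mpoly_int"
    assume IH: "\<And>m. m < n \<Longrightarrow> ?Q s m (s m)"
    have "of_nat p ^ n dvd G n - (\<Sum>i<n. of_nat p ^ i * s i ^ (p ^ (n - i)))"
    proof (cases n)
      case (Suc m)
      have Gm: "G m = (\<Sum>i\<le>m. of_nat p ^ i * s i ^ (p ^ (m - i)))"
        using IH[of m] Suc by (simp flip: lessThan_Suc_atMost)
      have "of_nat p ^ Suc m dvd (\<Sum>i\<le>m. of_nat p ^ i *
          (frob_lift p (s i) ^ (p ^ (m - i)) - (s i ^ p) ^ (p ^ (m - i))))"
      proof (rule dvd_sum)
        fix i assume i: "i \<in> {..m}"
        have "of_nat p ^ i * of_nat p ^ Suc (m - i) dvd of_nat p ^ i *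
          (frob_lift p (s i) ^ (p ^ (m - i)) - (s i ^ p) ^ (p ^ (m - i)))"
          by (intro mult_dvd_mono dvd_refl dvd_power_p_power_diff[OF p] frob_lift_cong[OF p])
        then show "of_nat p ^ Suc m dvd of_nat p ^ i *
          (frob_lift p (s i) ^ (p ^ (m - i)) - (s i ^ p) ^ (p ^ (m - i)))"
          using i by (simp flip: power_add power_Suc)
      qed
      also have "(\<Sum>i\<le>m. of_nat p ^ i *
          (frob_lift p (s i) ^ (p ^ (m - i)) - (s i ^ p) ^ (p ^ (m - i))))
         = frob_lift p (G m) - (\<Sum>i\<le>m. of_nat p ^ i * (s i ^ p) ^ (p ^ (m - i)))"
        by (simp add: Gm frob_lift_def mpeval_sum mpeval_mult mpeval_power right_diff_distrib sum_subtractf)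
      also have "(\<Sum>i\<le>m. of_nat p ^ i * (s i ^ p) ^ (p ^ (m - i)))
         = (\<Sum>i<n. of_nat p ^ i * s i ^ (p ^ (n - i)))"
        unfolding Suc lessThan_Suc_atMost
        by (intro sum.cong) (auto simp: Suc_diff_le simp flip: power_mult)
      finally have "of_nat p ^ n dvd (G n - frob_lift p (G m)) +
          (frob_lift p (G m) - (\<Sum>i<n. of_nat p ^ i * s i ^ (p ^ (n - i))))"
        using G[of m] Suc by (intro dvd_add) auto
      then show ?thesis by simp
    qed simp
    then obtain r where "G n - (\<Sum>i<n. of_nat p ^ i * s i ^ (p ^ (n - i))) = of_nat p ^ n * r"
      by (auto elim: dvdE)
    then show "\<exists>r. ?Q s n r" by (intro exI[of _ r]) (simp add: algebra_simps)
  qed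
  then obtain s where "\<forall>n. ghost p s n = G n" by (auto simp: ghost_split)
  moreover have "s = t" if "\<forall>n. ghost p s n = G n" "\<forall>n. ghost p t n = G n" for s t
    using that ghost_inj[of p s t] p prime_gt_0_nat by auto
  ultimately show ?thesis by auto
qed

lemma ghost_wvar_cong:
  "of_nat p ^ Suc n dvd ghost p (wvar j) (Suc n) - frob_lift p (ghost p (wvar j) n)"
proof -
  have "frob_lift p (ghost p (wvar j) n) = (\<Sum>i<Suc n. of_nat p ^ i * wvar j i ^ (p ^ (Suc n - i)))"
    unfolding lessThan_Suc_atMost frob_lift_def mpeval_ghost unfolding ghost_def mpeval_mpvar
    by (intro sum.cong) (auto simp: Suc_diff_le simp flip: power_mult)
  then show ?thesis by (simp add: ghost_split[of p _ "Suc n"])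
qed

lemma ghost_witt_S:
  assumes "prime p"
  shows "ghost p (witt_S p) n = ghost p (wvar 0) n + ghost p (wvar 1) n"
proof -
  have "\<exists>!s. \<forall>n. ghost p s n = ghost p (wvar 0) n + ghost p (wvar 1) n"
  proof (rule dwork_exists[OF assms])
    fix n
    show "of_nat p ^ Suc n dvd ghost p (wvar 0) (Suc n) + ghost p (wvar 1) (Suc n)
        - frob_lift p (ghost p (wvar 0) n + ghost p (wvar 1) n)"
      using dvd_add[OF ghost_wvar_cong[of p n 0] ghost_wvar_cong[of p n 1]]
      by (simp add: frob_lift_def mpeval_add algebra_simps)
  qed
  from theI'[OF this] show ?thesis by (simp add: witt_S_def)
qed

lemma ghost_witt_P:
  assumes "prime p"
  shows "ghost p (witt_P p) n = ghost p (wvar 0) n * ghost p (wvar 1) n"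
proof -
  have "\<exists>!s. \<forall>n. ghost p s n = ghost p (wvar 0) n * ghost p (wvar 1) n"
  proof (rule dwork_exists[OF assms])
    fix n
    let ?a = "ghost p (wvar 0) (Suc n)" and ?b = "ghost p (wvar 1) (Suc n)"
    let ?c = "frob_lift p (ghost p (wvar 0) n)" and ?d = "frob_lift p (ghost p (wvar 1) n)"
    have "of_nat p ^ Suc n dvd (?a - ?c) * ?b + ?c * (?b - ?d)"
      by (intro dvd_add dvd_mult2[OF ghost_wvar_cong] dvd_mult[OF ghost_wvar_cong])
    then show "of_nat p ^ Suc n dvd ?a * ?b - frob_lift p (ghost p (wvar 0) n * ghost p (wvar 1) n)"
      by (simp add: frob_lift_def mpeval_mult algebra_simps)
  qed
  from theI'[OF this] show ?thesis by (simp add: witt_P_def)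
qed

lemma ghost_witt_N:
  assumes "prime p"
  shows "ghost p (witt_N p) n = - ghost p (wvar 0) n"
proof -
  have "\<exists>!s. \<forall>n. ghost p s n = - ghost p (wvar 0) n"
  proof (rule dwork_exists[OF assms])
    fix n
    have "of_nat p ^ Suc n dvd - (ghost p (wvar 0) (Suc n) - frob_lift p (ghost p (wvar 0) n))"
      using ghost_wvar_cong[of p n 0] by (simp only: dvd_minus_iff)
    then show "of_nat p ^ Suc n dvd - ghost p (wvar 0) (Suc n) - frob_lift p (- ghost p (wvar 0) n)"
      by (simp add: frob_lift_def mpeval_uminus)
  qed
  from theI'[OF this] show ?thesis by (simp add: witt_N_def)
qed

definition wenv :: "(nat \<Rightarrow> 'a) \<Rightarrow> (nat \<Rightarrow> 'a) \<Rightarrow> nat \<times> nat \<Rightarrow> 'a" where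
  "wenv x y v = (if fst v = 0 then x (snd v) else y (snd v))"

definition wadd :: "nat \<Rightarrow> (nat \<Rightarrow> 'a::comm_ring_1) \<Rightarrow> (nat \<Rightarrow> 'a) \<Rightarrow> nat \<Rightarrow> 'a" where
  "wadd p x y n = mpeval (wenv x y) (witt_S p n)"

definition wmul :: "nat \<Rightarrow> (nat \<Rightarrow> 'a::comm_ring_1) \<Rightarrow> (nat \<Rightarrow> 'a) \<Rightarrow> nat \<Rightarrow> 'a" where
  "wmul p x y n = mpeval (wenv x y) (witt_P p n)"

definition wneg :: "nat \<Rightarrow> (nat \<Rightarrow> 'a::comm_ring_1) \<Rightarrow> nat \<Rightarrow> 'a" where
  "wneg p x n = mpeval (wenv x x) (witt_N p n)"

definition wone :: "nat \<Rightarrow> 'a::comm_ring_1" where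
  "wone n = (if n = 0 then 1 else 0)"

lemma ghost_wops:
  fixes x y :: "nat \<Rightarrow> 'v mpoly_int"
  assumes "prime p"
  shows "ghost p (wadd p x y) n = ghost p x n + ghost p y n"
    and "ghost p (wmul p x y) n = ghost p x n * ghost p y n"
    and "ghost p (wneg p x) n = - ghost p x n"
    and "ghost p (\<lambda>_. 0 :: 'v mpoly_int) n = 0"
    and "ghost p (wone :: nat \<Rightarrow> 'v mpoly_int) n = 1"
proof -
  have p: "p > 0" using assms prime_gt_0_nat by blast
  have v: "mpeval (wenv x y) (ghost p (wvar 0) n) = ghost p x n"
     "mpeval (wenv x y) (ghost p (wvar 1) n) = ghost p y n"
     for x y :: "nat \<Rightarrow> 'v mpoly_int"
    by (simp_all add: mpeval_ghost wenv_def)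
  show "ghost p (wadd p x y) n = ghost p x n + ghost p y n"
    using mpeval_ghost[of "wenv x y" p "witt_S p" n]
    by (simp add: ghost_witt_S[OF assms] mpeval_add v[simplified] wadd_def[abs_def])
  show "ghost p (wmul p x y) n = ghost p x n * ghost p y n"
    using mpeval_ghost[of "wenv x y" p "witt_P p" n]
    by (simp add: ghost_witt_P[OF assms] mpeval_mult v[simplified] wmul_def[abs_def])
  show "ghost p (wneg p x) n = - ghost p x n"
    using mpeval_ghost[of "wenv x x" p "witt_N p" n]
    by (simp add: ghost_witt_N[OF assms] mpeval_uminus v[simplified] wneg_def[abs_def])
  show "ghost p (\<lambda>_. 0 :: 'v mpoly_int) n = 0"
    using p by (simp add: ghost_def power_0_left)
  have "ghost p (wone :: nat \<Rightarrow> 'v mpoly_int) n = (\<Sum>i\<in>{..n}. if i = 0 then 1 else 0)"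
    unfolding ghost_def by (intro sum.cong) (use p in \<open>auto simp: wone_def power_0_left\<close>)
  then show "ghost p (wone :: nat \<Rightarrow> 'v mpoly_int) n = 1" by simp
qed

lemma mpeval_wops:
  "(\<lambda>n. mpeval f (wadd p x y n)) = wadd p (\<lambda>n. mpeval f (x n)) (\<lambda>n. mpeval f (y n))"
  "(\<lambda>n. mpeval f (wmul p x y n)) = wmul p (\<lambda>n. mpeval f (x n)) (\<lambda>n. mpeval f (y n))"
  "(\<lambda>n. mpeval f (wneg p x n)) = wneg p (\<lambda>n. mpeval f (x n))"
  "(\<lambda>n. mpeval f (wone n)) = wone"
  by (auto simp: wadd_def wmul_def wneg_def wone_def mpeval_comp wenv_def
      intro!: ext arg_cong[of _ _ "\<lambda>e. mpeval e _"])

text \<open>Ring identities hold for the universal vectors, where \<open>ghost\<close> is injective, and are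
  specialised to arbitrary rings by evaluation.\<close>

lemma witt_ring_identities:
  fixes x y z :: "nat \<Rightarrow> 'a::comm_ring_1"
  assumes "prime p"
  shows "wadd p (wadd p x y) z = wadd p x (wadd p y z)"
    and "wadd p x y = wadd p y x"
    and "wadd p (\<lambda>_. 0) x = x"
    and "wadd p (wneg p x) x = (\<lambda>_. 0)"
    and "wmul p (wmul p x y) z = wmul p x (wmul p y z)"
    and "wmul p x y = wmul p y x"
    and "wmul p wone x = x"
    and "wmul p (wadd p x y) z = wadd p (wmul p x z) (wmul p y z)"
proof -
  have p: "p > 0" using assms prime_gt_0_nat by blast
  define e where "e v = (if fst v = 0 then x (snd v) else if fst v = 1 then y (snd v) else z (snd v))"
    for v :: "nat \<times> nat"
  define X Y Z where "X = wvar 0" and "Y = wvar 1" and "Z = wvar 2"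
  have e: "(\<lambda>n. mpeval e (X n)) = x" "(\<lambda>n. mpeval e (Y n)) = y" "(\<lambda>n. mpeval e (Z n)) = z"
    by (simp_all add: X_def Y_def Z_def e_def)
  have transfer: "(\<lambda>n. mpeval e (s n)) = (\<lambda>n. mpeval e (t n))"
    if "\<And>n. ghost p s n = ghost p t n" for s t
    using ghost_inj[OF p that] by simp
  note g = ghost_wops[OF assms]
  show "wadd p (wadd p x y) z = wadd p x (wadd p y z)"
    using transfer[of "wadd p (wadd p X Y) Z" "wadd p X (wadd p Y Z)"]
    by (simp add: g mpeval_wops e add.assoc)
  show "wadd p x y = wadd p y x"
    using transfer[of "wadd p X Y" "wadd p Y X"] by (simp add: g mpeval_wops e add.commute)
  show "wadd p (\<lambda>_. 0) x = x"
    using transfer[of "wadd p (\<lambda>_. 0) X" X] by (simp add: g mpeval_wops e)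
  show "wadd p (wneg p x) x = (\<lambda>_. 0)"
    using transfer[of "wadd p (wneg p X) X" "\<lambda>_. 0"] by (simp add: g mpeval_wops e)
  show "wmul p (wmul p x y) z = wmul p x (wmul p y z)"
    using transfer[of "wmul p (wmul p X Y) Z" "wmul p X (wmul p Y Z)"]
    by (simp add: g mpeval_wops e mult.assoc)
  show "wmul p x y = wmul p y x"
    using transfer[of "wmul p X Y" "wmul p Y X"] by (simp add: g mpeval_wops e mult.commute)
  show "wmul p wone x = x"
    using transfer[of "wmul p wone X" X] by (simp add: g mpeval_wops e)
  show "wmul p (wadd p x y) z = wadd p (wmul p x z) (wmul p y z)"
    using transfer[of "wmul p (wadd p X Y) Z" "wadd p (wmul p X Z) (wmul p Y Z)"]
    by (simp add: g mpeval_wops e distrib_right)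
qed


section \<open>The ring of Witt vectors\<close>

text \<open>\<open>p\<close>-typical Witt vectors over a ring of prime characteristic \<open>p\<close>; the prime is determined
  by the coefficient ring as \<open>CHAR('a)\<close>.\<close>

datatype 'a witt = Witt (witt_nth: "nat \<Rightarrow> 'a")

instantiation witt :: (comm_ring_prime_char) comm_ring_1
begin

definition zero_witt :: "'a witt" where "0 = Witt (\<lambda>_. 0)"
definition one_witt :: "'a witt" where "1 = Witt wone"
definition plus_witt :: "'a witt \<Rightarrow> 'a witt \<Rightarrow> 'a witt" where
  "a + b = Witt (wadd CHAR('a) (witt_nth a) (witt_nth b))"
definition times_witt :: "'a witt \<Rightarrow> 'a witt \<Rightarrow> 'a witt" where
  "a * b = Witt (wmul CHAR('a) (witt_nth a) (witt_nth b))"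
definition uminus_witt :: "'a witt \<Rightarrow> 'a witt" where
  "- a = Witt (wneg CHAR('a) (witt_nth a))"
definition minus_witt :: "'a witt \<Rightarrow> 'a witt \<Rightarrow> 'a witt" where
  "a - b = a + - (b :: 'a witt)"

instance
proof
  have *: "prime CHAR('a)" by simp
  note ids = witt_ring_identities[OF *, where ?'a = 'a]
  fix a b c :: "'a witt"
  show "a + b + c = a + (b + c)" by (simp add: plus_witt_def ids(1))
  show "a + b = b + a" by (simp add: plus_witt_def ids(2)[of "witt_nth a"])
  show "0 + a = a" by (simp add: plus_witt_def zero_witt_def ids(3))
  show "- a + a = 0" by (simp add: plus_witt_def uminus_witt_def zero_witt_def ids(4))
  show "a - b = a + - b" by (rule minus_witt_def)
  show "a * b * c = a * (b * c)" by (simp add: times_witt_def ids(5))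
  show "a * b = b * a" by (simp add: times_witt_def ids(6)[of "witt_nth a"])
  show "1 * a = a" by (simp add: times_witt_def one_witt_def ids(7))
  show "(a + b) * c = a * c + b * c" by (simp add: times_witt_def plus_witt_def ids(8))
  have "wone 0 \<noteq> (0 :: 'a)" by (simp add: wone_def)
  then show "(0 :: 'a witt) \<noteq> 1" by (metis one_witt_def witt.inject zero_witt_def)
qed

end

text \<open>The endomorphism induced by functoriality from \<open>x \<mapsto> x\<^sup>p\<close> on the coefficients.\<close>

definition witt_frob :: "'a::comm_ring_prime_char witt \<Rightarrow> 'a witt" where
  "witt_frob a = Witt (\<lambda>n. witt_nth a n ^ CHAR('a))"


section \<open>$F$-crystals\<close>

definition (in module) basis_family :: "'i set \<Rightarrow> ('i \<Rightarrow> 'b) \<Rightarrow> bool" where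
  "basis_family I v \<longleftrightarrow> inj_on v I \<and> independent (v ` I) \<and> span (v ` I) = UNIV"

definition frob_semilinear ::
  "('k::comm_ring_prime_char witt \<Rightarrow> 'm::ab_group_add \<Rightarrow> 'm) \<Rightarrow> ('m \<Rightarrow> 'm) \<Rightarrow> bool" where
  "frob_semilinear scale \<phi> \<longleftrightarrow>
     (\<forall>x y. \<phi> (x + y) = \<phi> x + \<phi> y) \<and> (\<forall>a x. \<phi> (scale a x) = scale (witt_frob a) (\<phi> x))"

locale F_crystal = module scale
  for scale :: "'k::{alg_closed_field, field_prime_char} witt \<Rightarrow> 'm::ab_group_add \<Rightarrow> 'm" +
  fixes \<phi> :: "'m \<Rightarrow> 'm"
  assumes free: "\<exists>(r::nat) v. basis_family {1..r} v"
    and semilinear: "frob_semilinear scale \<phi>"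
    and inj: "inj \<phi>"

text \<open>\<open>\<phi>\<close> has rank \<open>r\<close> and Hodge slopes \<open>e\<^sub>1, \<dots>, e\<^sub>r\<close>, in no particular order;
  only the values of \<open>e\<close> on \<open>{1..r}\<close> matter.\<close>

definition (in F_crystal) hodge_slopes :: "nat \<Rightarrow> (nat \<Rightarrow> nat) \<Rightarrow> bool" where
  "hodge_slopes r e \<longleftrightarrow> (\<exists>u w. basis_family {1..r} u \<and> basis_family {1..r} w \<and>
     (\<forall>i\<in>{1..r}. \<phi> (u i) = scale (of_nat CHAR('k) ^ e i) (w i)))"

definition F_crystal_iso ::
  "('k::{alg_closed_field, field_prime_char} witt \<Rightarrow> 'm::ab_group_add \<Rightarrow> 'm) \<Rightarrow> ('m \<Rightarrow> 'm) \<Rightarrow>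
   ('k witt \<Rightarrow> 'n::ab_group_add \<Rightarrow> 'n) \<Rightarrow> ('n \<Rightarrow> 'n) \<Rightarrow> bool" where
  "F_crystal_iso scale \<phi> scale' \<phi>' \<longleftrightarrow> F_crystal scale \<phi> \<and> F_crystal scale' \<phi>' \<and>
     (\<exists>h. module_hom scale scale' h \<and> bij h \<and> (\<forall>x. h (\<phi> x) = \<phi>' (h x)))"

definition GL_module :: "('a::comm_ring_1 \<Rightarrow> 'm::ab_group_add \<Rightarrow> 'm) \<Rightarrow> ('m \<Rightarrow> 'm) set" where
  "GL_module scale = {g. module_hom scale scale g \<and> bij g}"

text \<open>\<open>g\<close> and \<open>h\<close> induce the same map on \<open>M/cM\<close>.\<close>

definition cong_mod :: "('a::comm_ring_1 \<Rightarrow> 'm::ab_group_add \<Rightarrow> 'm) \<Rightarrow> 'a \<Rightarrow> ('m \<Rightarrow> 'm) \<Rightarrow> ('m \<Rightarrow> 'm) \<Rightarrow> bool"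
  where "cong_mod scale c g h \<longleftrightarrow> (\<forall>x. g x - h x \<in> range (scale c))"

end

theory Submission
  imports Defs "HOL-Combinatorics.Orbits" "HOL-Library.Function_Algebras"
begin

text \<open>Reduce modulo \<open>p\<close>: the bases with \<open>\<phi> u\<^sub>i = p^(e\<^sub>i) w\<^sub>i\<close> give a decreasing filtration
  by the spans of the \<open>u\<^sub>i\<close>, an increasing one by the spans of the \<open>w\<^sub>i\<close>, and Frobenius-semilinear
  isomorphisms between their graded pieces. A basis \<open>v\<close> of the reduction that is adapted to the first
  filtration and whose graded images are permuted, modulo the smaller steps of the second, lifts to a
  basis of \<open>M\<close> with \<open>\<phi> v\<^sub>i = p^(e\<^sub>i) y\<^sub>i\<close> and \<open>y\<^sub>i\<close> congruent to \<open>v\<^bsub>\<pi> i\<^esub>\<close>; then \<open>g\<close> is the change of basis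
  from \<open>v\<^bsub>\<pi> i\<^esub>\<close> to \<open>y\<^sub>i\<close>, and \<open>g \<phi>\<^sub>\<pi>\<close> is \<open>\<phi>\<close> itself. To find \<open>v\<close>, choose a common adapted basis of both
  filtrations (Bruhat decomposition). This splits the space into blocks, and the filtrations induced
  on the blocks pose the same problem again; the number of blocks grows until the semilinear map
  permutes them, where Lang's theorem applies.\<close>

section \<open>Multiplication by $p$ on Witt vectors\<close>

text \<open>Since \<open>g\<close> is prescribed only modulo p, everything divisible by p is free:
  the problem lives modulo p, and no successive approximation over W(k) occurs. For v = sum of c_l
  u_l one has phi v = sum of sigma(c_l) p^(e_l) w_l. Divisibility by p^(e_i) is obtained by taking
  c_l divisible by p^(e_i - e_l) whenever e_l < e_i; after division by p^(e_i) the terms with e_l >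
  e_i vanish modulo p. So modulo p the vector v_i uses the levels at least e_i, its image uses the
  levels at most e_i, and only the level e_i couples the two through Frobenius. This is the origin
  of the two opposite filtrations. The obstacle is that the graded map need not send the leading
  terms of a common adapted basis to leading terms of the same basis. What rescues the argument is
  that only leading terms matter: the semilinear map F may be exchanged for a map F' with
  corresponding leading terms that hits the common basis exactly, and F' poses the problem again on
  smaller blocks.\<close>

lemma ghost_cong_imp_coeff_cong:
  fixes x y :: "nat \<Rightarrow> 'v mpoly_int"
  assumes p: "prime p" and cong: "\<And>n. of_nat p ^ Suc n dvd ghost p x n - ghost p y n"
  shows "of_nat p dvd x n - y n"
proof (induction n rule: less_induct)
  case (less n)
  let ?s = "\<Sum>i<n. of_nat p ^ i * (x i ^ (p ^ (n - i)) - y i ^ (p ^ (n - i)))"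
  \<comment> \<open>The lower terms are harmless: a congruence modulo p improves to one modulo
    p^(n-i+1) after raising to the power p^(n-i), and the factor p^i supplies the rest. What remains
    is p^n times the wanted difference, and p^n cancels in integer polynomials.\<close>
  have "of_nat p ^ Suc n dvd ?s"
  proof (rule dvd_sum)
    fix i assume i: "i \<in> {..<n}"
    have "of_nat p ^ i * of_nat p ^ Suc (n - i)
        dvd of_nat p ^ i * (x i ^ (p ^ (n - i)) - y i ^ (p ^ (n - i)))"
      using i less by (intro mult_dvd_mono dvd_refl dvd_power_p_power_diff[OF p]) auto
    then show "of_nat p ^ Suc n dvd of_nat p ^ i * (x i ^ (p ^ (n - i)) - y i ^ (p ^ (n - i)))"
      using i by (simp flip: power_add power_Suc)
  qed
  then have "of_nat p ^ Suc n dvd (ghost p x n - ghost p y n) - ?s"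
    using cong by (rule dvd_diff[rotated])
  moreover have "(ghost p x n - ghost p y n) - ?s = of_nat p ^ n * (x n - y n)"
    by (simp add: ghost_split right_diff_distrib sum_subtractf)
  ultimately obtain q where "of_nat p ^ n * (x n - y n) = of_nat p ^ Suc n * q"
    by (auto elim: dvdE)
  then have "of_nat (p ^ n) * (x n - y n) = of_nat (p ^ n) * (of_nat p * q)"
    by (simp add: mult_ac)
  then have "x n - y n = of_nat p * q"
    by (rule mpoly_int_of_nat_mult_cancel[rotated]) (use p prime_gt_0_nat in auto)
  then show ?case by simp
qed

lemma ghost_shift:
  "ghost p (\<lambda>i. if i = 0 then 0 else y (i - 1)) n
    = (if n = 0 then 0 else of_nat p * ghost p y (n - 1))" if "p > 0"
proof (cases n)
  case 0
  then show ?thesis by (simp add: ghost_def)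
next
  case (Suc m)
  then have "ghost p (\<lambda>i. if i = 0 then 0 else y (i - 1)) n
      = (\<Sum>i\<le>m. of_nat p ^ Suc i * y i ^ (p ^ (m - i)))"
    using that by (simp add: ghost_def sum.atMost_Suc_shift power_0_left del: sum.atMost_Suc)
  then show ?thesis using Suc by (simp add: ghost_def sum_distrib_left mult.assoc)
qed

lemma ghost_frob_powers:
  "ghost p (\<lambda>i. x i ^ p) n = ghost p x (Suc n) - of_nat p ^ Suc n * x (Suc n)"
  unfolding ghost_split[of p x] unfolding ghost_def lessThan_Suc_atMost
  by (simp add: Suc_diff_le flip: power_mult)

text \<open>In characteristic \<open>p\<close>, multiplication by \<open>p\<close> is Verschiebung after Frobenius: over the
  integers the ghost components of both sides agree modulo \<open>p\<^bsup>n+1\<^esup>\<close>.\<close>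

lemma witt_nth_p_mult:
  fixes a :: "'a::comm_ring_prime_char witt"
  shows "witt_nth (of_nat CHAR('a) * a) n = (if n = 0 then 0 else witt_nth a (n - 1) ^ CHAR('a))"
proof -
  define p where "p = CHAR('a)"
  have p: "prime p" and p0: "p > 0" by (simp_all add: p_def CHAR_pos_iff prime_gt_0_nat)
  define X where "X = wvar 0"
  define N :: "nat \<Rightarrow> nat \<Rightarrow> (nat \<times> nat) mpoly_int"
    where "N = rec_nat (\<lambda>_. 0) (\<lambda>_. wadd p wone)"
  have N: "N 0 = (\<lambda>_. 0)" "N (Suc k) = wadd p wone (N k)" for k
    by (simp_all add: N_def)
  define ev where "ev = (\<lambda>v::nat \<times> nat. witt_nth a (snd v))"
  have evN: "(\<lambda>n. mpeval ev (N k n)) = witt_nth (of_nat k :: 'a witt)" for k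
  proof (induction k)
    case 0
    then show ?case by (simp add: N zero_witt_def)
  next
    case (Suc k)
    then show ?case by (simp add: N mpeval_wops plus_witt_def one_witt_def p_def)
  qed
  have ghN: "ghost p (N k) n = of_nat k" for k n
    by (induction k) (simp_all add: N ghost_wops[OF p])
  let ?Y = "\<lambda>i. if i = 0 then 0 else (\<lambda>i. X i ^ p) (i - 1)"
  have "of_nat p dvd wmul p (N p) X n - ?Y n"
  proof (rule ghost_cong_imp_coeff_cong[OF p, of "wmul p (N p) X" ?Y])
    fix n
    show "of_nat p ^ Suc n dvd ghost p (wmul p (N p) X) n - ghost p ?Y n"
    proof (cases n)
      case 0
      then show ?thesis using ghost_shift[OF p0, of "\<lambda>i. X i ^ p" n] by (simp add: ghost_wops[OF p] ghN)
    next
      case (Suc m)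
      have "ghost p (wmul p (N p) X) n - ghost p ?Y n = of_nat p ^ Suc n * X n"
        unfolding ghost_shift[OF p0, of "\<lambda>i. X i ^ p"] ghost_wops[OF p] ghN ghost_frob_powers
        using Suc by (simp add: algebra_simps)
      then show ?thesis by simp
    qed
  qed
  then obtain Q where "wmul p (N p) X n - ?Y n = of_nat p * Q" by (auto elim: dvdE)
  then have "mpeval ev (wmul p (N p) X n - ?Y n) = 0"
    by (simp add: mpeval_mult p_def)
  moreover have "mpeval ev (wmul p (N p) X n) = witt_nth (of_nat p * a) n"
    using mpeval_wops(2)[of ev p "N p" X, THEN fun_cong, of n]
    by (simp add: times_witt_def p_def[symmetric] evN) (simp add: X_def ev_def)
  ultimately show ?thesis
    by (auto simp: mpeval_diff X_def ev_def mpeval_power p_def split: if_splits)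
qed

text \<open>The zeroth ghost component is the zeroth coordinate itself, so this coordinate obeys the
  operations of the coefficient ring. It is the residue map W(k) -> k.\<close>

lemma witt_nth_0_hom:
  fixes a b :: "'a::comm_ring_prime_char witt"
  shows "witt_nth (a + b) 0 = witt_nth a 0 + witt_nth b 0"
    and "witt_nth (a * b) 0 = witt_nth a 0 * witt_nth b 0"
    and "witt_nth (0 :: 'a witt) 0 = 0"
    and "witt_nth (1 :: 'a witt) 0 = 1"
proof -
  define p where "p = CHAR('a)"
  have p: "prime p" by (simp add: p_def)
  have g0: "ghost p s 0 = s 0" for s :: "nat \<Rightarrow> (nat \<times> nat) mpoly_int"
    by (simp add: ghost_def)
  have "witt_S p 0 = wvar 0 0 + wvar 1 0" "witt_P p 0 = wvar 0 0 * wvar 1 0"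
    using ghost_witt_S[OF p, of 0] ghost_witt_P[OF p, of 0] by (simp_all add: g0)
  then show "witt_nth (a + b) 0 = witt_nth a 0 + witt_nth b 0"
    and "witt_nth (a * b) 0 = witt_nth a 0 * witt_nth b 0"
    by (simp_all add: plus_witt_def times_witt_def wadd_def wmul_def p_def[symmetric]
        mpeval_add mpeval_mult wenv_def)
qed (simp_all add: zero_witt_def one_witt_def wone_def)

lemma witt_nth_0_minus:
  fixes a b :: "'a::comm_ring_prime_char witt"
  shows "witt_nth (a - b) 0 = witt_nth a 0 - witt_nth b 0"
  using witt_nth_0_hom(1)[of "a - b" b] by simp

text \<open>The Teichmueller representative [x], a section of the residue map.\<close>

definition witt_const :: "'a::zero \<Rightarrow> 'a witt" where
  "witt_const x = Witt (\<lambda>n. if n = 0 then x else 0)"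

lemma witt_nth_const_0 [simp]: "witt_nth (witt_const x) 0 = x"
  by (simp add: witt_const_def)

text \<open>Witt vectors with disjoint supports add coordinatewise: each index of a ghost sum
  receives a contribution from only one of them, and ghost components determine a vector over
  integer polynomials.\<close>

lemma witt_split_head:
  fixes a :: "'a::comm_ring_prime_char witt"
  shows "a = witt_const (witt_nth a 0) + Witt (\<lambda>n. if n = 0 then 0 else witt_nth a n)"
proof -
  define p where "p = CHAR('a)"
  have p: "prime p" and p0: "p > 0" by (simp_all add: p_def CHAR_pos_iff prime_gt_0_nat)
  define X where "X = wvar 0"
  define H T where "H = (\<lambda>n::nat. if n = 0 then X 0 else 0)"
    and "T = (\<lambda>n::nat. if n = 0 then 0 else X n)"
  define ev where "ev = (\<lambda>v::nat \<times> nat. witt_nth a (snd v))"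
  have "wadd p H T = X"
  proof (rule ghost_inj[OF p0])
    fix n
    have "ghost p H n + ghost p T n
        = (\<Sum>i\<le>n. of_nat p ^ i * H i ^ (p ^ (n - i)) + of_nat p ^ i * T i ^ (p ^ (n - i)))"
      by (simp add: ghost_def sum.distrib)
    also have "\<dots> = ghost p X n"
      unfolding ghost_def by (intro sum.cong refl) (use p0 in \<open>auto simp: H_def T_def power_0_left\<close>)
    finally show "ghost p (wadd p H T) n = ghost p X n" by (simp add: ghost_wops[OF p])
  qed
  then have "(\<lambda>n. mpeval ev (wadd p H T n)) = (\<lambda>n. mpeval ev (X n))" by simp
  moreover have "(\<lambda>n. mpeval ev (H n)) = witt_nth (witt_const (witt_nth a 0))"
    "(\<lambda>n. mpeval ev (T n)) = (\<lambda>n. if n = 0 then 0 else witt_nth a n)"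
    "(\<lambda>n. mpeval ev (X n)) = witt_nth a"
    by (auto simp: H_def T_def X_def ev_def witt_const_def)
  ultimately show ?thesis
    by (simp add: mpeval_wops plus_witt_def p_def)
qed

section \<open>Witt vectors over an algebraically closed field\<close>

lemma char_root_exists:
  "\<exists>y :: 'k::{alg_closed_field, field_prime_char}. y ^ CHAR('k) = x"
  using nth_root_exists[of "CHAR('k)" x] by (simp add: CHAR_pos_iff pos_char_exists)

text \<open>Multiplication by p is Verschiebung after Frobenius, so its image has zeroth coordinate
  0; p-th roots in k make the image all such vectors. Hence W(k)/p is k.\<close>

lemma p_dvd_witt_iff:
  fixes a :: "'k::{alg_closed_field, field_prime_char} witt"
  shows "of_nat CHAR('k) dvd a \<longleftrightarrow> witt_nth a 0 = 0"
proof
  assume "of_nat CHAR('k) dvd a"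
  then show "witt_nth a 0 = 0" by (auto elim!: dvdE simp: witt_nth_p_mult)
next
  assume 0: "witt_nth a 0 = 0"
  obtain R :: "'k \<Rightarrow> 'k" where R: "\<And>x. R x ^ CHAR('k) = x"
    using char_root_exists by metis
  have "a = of_nat CHAR('k) * Witt (\<lambda>n. R (witt_nth a (Suc n)))"
    by (rule witt.expand) (use 0 in \<open>auto simp: witt_nth_p_mult R fun_eq_iff\<close>)
  then show "of_nat CHAR('k) dvd a" by (metis dvd_triv_left)
qed

lemma witt_nth_p_power_mult:
  fixes a :: "'a::comm_ring_prime_char witt"
  assumes "m < n"
  shows "witt_nth (of_nat CHAR('a) ^ n * a) m = 0"
  using assms
proof (induction n arbitrary: m)
  case (Suc n)
  have "CHAR('a) > 0" by (simp add: prime_gt_0_nat)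
  with Suc show ?case by (cases m) (simp_all add: mult.assoc witt_nth_p_mult power_0_left)
qed simp

text \<open>A multiple of p^n has its first n coordinates 0. This p-adic separatedness turns
  congruences modulo every p^n into equalities.\<close>

lemma witt_eq_0_if_p_powers_dvd:
  fixes a :: "'a::comm_ring_prime_char witt"
  assumes "\<And>n. of_nat CHAR('a) ^ n dvd a"
  shows "a = 0"
proof (rule witt.expand, rule ext)
  fix m
  obtain b where "a = of_nat CHAR('a) ^ Suc m * b" using assms by (blast elim: dvdE)
  then show "witt_nth a m = witt_nth 0 m"
    by (simp only: witt_nth_p_power_mult[of m "Suc m"] lessI) (simp add: zero_witt_def)
qed

text \<open>\<open>(s\<^sub>0, s\<^sub>1\<^sup>p, s\<^sub>2\<^bsup>p\<^sup>2\<^esup>, \<dots>)\<close> is the \<open>p\<close>-adically convergent sum of the \<open>p\<^sup>i [s\<^sub>i]\<close>.\<close>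

definition witt_digits :: "(nat \<Rightarrow> 'a::comm_ring_prime_char) \<Rightarrow> 'a witt" where
  "witt_digits s = Witt (\<lambda>n. s n ^ (CHAR('a) ^ n))"

lemma witt_digits_unfold:
  fixes s :: "nat \<Rightarrow> 'a::comm_ring_prime_char"
  shows "witt_digits s = witt_const (s 0) + of_nat CHAR('a) * witt_digits (\<lambda>n. s (Suc n))"
proof -
  have "Witt (\<lambda>n. if n = 0 then 0 else witt_nth (witt_digits s) n)
      = of_nat CHAR('a) * witt_digits (\<lambda>n. s (Suc n))"
  proof (rule witt.expand, rule ext)
    fix n
    show "witt_nth (Witt (\<lambda>n. if n = 0 then 0 else witt_nth (witt_digits s) n)) n
        = witt_nth (of_nat CHAR('a) * witt_digits (\<lambda>n. s (Suc n))) n"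
      by (cases n) (simp_all add: witt_digits_def witt_nth_p_mult mult.commute flip: power_mult)
  qed
  then show ?thesis
    using witt_split_head[of "witt_digits s"] by (simp add: witt_digits_def)
qed

text \<open>The inverse is found by long division: starting from 1, \<open>d\<close> picks the digit
  that makes the remainder divisible by p, and \<open>nxt\<close> is the quotient. The product of
  \<open>a\<close> with the assembled digits differs from 1 by a multiple of every p^n. Hence W(k)
  is local with maximal ideal (p).\<close>

lemma witt_unit:
  fixes a :: "'k::{alg_closed_field, field_prime_char} witt"
  assumes a: "witt_nth a 0 \<noteq> 0"
  shows "a dvd 1"
proof -
  define p :: "'k witt" where "p = of_nat CHAR('k)"
  define d where "d c = witt_nth c 0 / witt_nth a 0" for c :: "'k witt"
  have "p dvd c - a * witt_const (d c)" for c
    using a by (simp add: p_def p_dvd_witt_iff d_def witt_nth_0_minus witt_nth_0_hom)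
  then have "\<exists>nxt. \<forall>c. c - a * witt_const (d c) = p * nxt c"
    unfolding dvd_def by (intro choice allI)
  then obtain nxt where nxt: "\<And>c. c - a * witt_const (d c) = p * nxt c"
    by blast
  define c where "c n = (nxt ^^ n) 1" for n
  define s where "s n = d (c n)" for n
  have step: "c n - a * witt_digits (\<lambda>i. s (n + i))
      = p * (c (Suc n) - a * witt_digits (\<lambda>i. s (Suc n + i)))" for n
  proof -
    have "witt_digits (\<lambda>i. s (n + i)) = witt_const (d (c n)) + p * witt_digits (\<lambda>i. s (Suc n + i))"
      using witt_digits_unfold[of "\<lambda>i. s (n + i)"] by (simp add: p_def s_def)
    then have "c n - a * witt_digits (\<lambda>i. s (n + i))
        = (c n - a * witt_const (d (c n))) - p * (a * witt_digits (\<lambda>i. s (Suc n + i)))"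
      by (simp add: algebra_simps)
    also have "c n - a * witt_const (d (c n)) = p * c (Suc n)"
      by (simp add: nxt c_def)
    finally show ?thesis by (simp add: right_diff_distrib)
  qed
  have "1 - a * witt_digits s = p ^ n * (c n - a * witt_digits (\<lambda>i. s (n + i)))" for n
  proof (induction n)
    case 0
    then show ?case by (simp add: c_def)
  next
    case (Suc n)
    then show ?case unfolding step[of n] power_Suc2 mult.assoc .
  qed
  then have "1 - a * witt_digits s = 0"
    unfolding p_def by (intro witt_eq_0_if_p_powers_dvd dvdI)
  then have "1 = a * witt_digits s" by simp
  then show ?thesis by (rule dvdI)
qed

lemma witt_nth_frob [simp]: "witt_nth (witt_frob a) n = witt_nth (a :: 'a::comm_ring_prime_char witt) n ^ CHAR('a)"
  by (simp add: witt_frob_def)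

lemma witt_frob_p_power_mult:
  fixes a :: "'a::comm_ring_prime_char witt"
  shows "witt_frob (of_nat CHAR('a) ^ n * a) = of_nat CHAR('a) ^ n * witt_frob a"
proof (induction n)
  case (Suc n)
  have p0: "CHAR('a) > 0" by (simp add: prime_gt_0_nat)
  have "witt_frob (of_nat CHAR('a) * b) = of_nat CHAR('a) * witt_frob b" for b :: "'a witt"
    by (rule witt.expand) (use p0 in \<open>auto simp: witt_nth_p_mult fun_eq_iff power_0_left\<close>)
  with Suc show ?case by (simp add: mult.assoc)
qed simp

section \<open>Families of vectors\<close>

text \<open>Indexed families instead of sets, because blocks, levels and permutations live on the
  indices; with spanning added this is \<open>basis_family\<close>.\<close>

definition (in module) indep_family :: "'i set \<Rightarrow> ('i \<Rightarrow> 'b) \<Rightarrow> bool" where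
  "indep_family I v \<longleftrightarrow> inj_on v I \<and> independent (v ` I)"

lemma (in module) sum_in_span: "(\<Sum>i\<in>J. c i *s v i) \<in> span (v ` J)"
  by (intro span_sum span_scale span_base) auto

lemma (in module) span_family_mono: "x \<in> span (v ` J) \<Longrightarrow> J \<subseteq> K \<Longrightarrow> x \<in> span (v ` K)"
  using span_mono[OF image_mono] by blast

lemma (in module) span_family_trans:
  assumes "x \<in> span (v ` J)" "\<And>l. l \<in> J \<Longrightarrow> v l \<in> span S"
  shows "x \<in> span S"
  using assms span_minimal[of "v ` J" "span S"] by blast

lemma (in module) span_familyE:
  assumes "x \<in> span (v ` J)" "finite J"
  obtains c where "x = (\<Sum>i\<in>J. c i *s v i)"
proof -
  from assms(1) have "\<exists>c. x = (\<Sum>i\<in>J. c i *s v i)"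
  proof (induction rule: span_induct_alt)
    case base
    show ?case by (intro exI[of _ "\<lambda>_. 0"]) simp
  next
    case (step c x y)
    then obtain j b where j: "j \<in> J" "x = v j" and b: "y = (\<Sum>i\<in>J. b i *s v i)" by auto
    have "(\<Sum>i\<in>J. (if i = j then c else 0) *s v i) = c *s x"
      using j assms(2) by (simp add: if_distrib[of "\<lambda>c. c *s _"] sum.delta cong: if_cong)
    then have "c *s x + y = (\<Sum>i\<in>J. ((if i = j then c else 0) + b i) *s v i)"
      by (simp add: b scale_left_distrib sum.distrib)
    then show ?case by (rule exI[of _ "\<lambda>i. (if i = j then c else 0) + b i"])
  qed
  then show ?thesis using that by blast
qed

lemma (in module) indep_familyD:
  assumes "indep_family I v" "finite I" "(\<Sum>i\<in>I. c i *s v i) = 0" "i \<in> I"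
  shows "c i = 0"
proof -
  have inj: "inj_on v I" and ind: "independent (v ` I)"
    using assms(1) by (auto simp: indep_family_def)
  have "(\<Sum>x\<in>v ` I. c (the_inv_into I v x) *s x) = (\<Sum>i\<in>I. c i *s v i)"
    by (subst sum.reindex[OF inj]) (auto simp: the_inv_into_f_f[OF inj] intro!: sum.cong)
  then have "c (the_inv_into I v (v i)) = 0"
    using assms by (intro independentD[OF ind finite_imageI[OF assms(2)] order_refl]) auto
  then show ?thesis using assms(4) by (simp add: the_inv_into_f_f[OF inj])
qed

lemma (in module) indep_familyI:
  assumes fin: "finite I" and *: "\<And>c i. (\<Sum>i\<in>I. c i *s v i) = 0 \<Longrightarrow> i \<in> I \<Longrightarrow> c i = 0"
  shows "indep_family I v"
proof -
  have inj: "inj_on v I"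
  proof (rule inj_onI, rule ccontr)
    fix i j assume ij: "i \<in> I" "j \<in> I" "v i = v j" "i \<noteq> j"
    define c :: "_ \<Rightarrow> 'a" where "c l = (if l = i then 1 else 0) - (if l = j then 1 else 0)" for l
    have "(\<Sum>l\<in>I. c l *s v l) = v i - v j"
      using ij fin by (simp add: c_def scale_left_diff_distrib sum_subtractf
          if_distrib[of "\<lambda>c. c *s _"] sum.delta cong: if_cong)
    then have "c i = 0" using ij by (intro *) auto
    then show False using ij by (simp add: c_def)
  qed
  moreover have "independent (v ` I)"
  proof
    assume "dependent (v ` I)"
    then obtain u x where u: "x \<in> v ` I" "u x \<noteq> 0" "(\<Sum>x\<in>v ` I. u x *s x) = 0"
      using dependent_finite[OF finite_imageI[OF fin]] by blast
    from u(1) obtain i where i: "i \<in> I" "x = v i" by auto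
    have "(\<Sum>i\<in>I. u (v i) *s v i) = 0" using u(3) by (simp add: sum.reindex[OF inj])
    from *[OF this i(1)] u(2) i(2) show False by simp
  qed
  ultimately show ?thesis by (simp add: indep_family_def)
qed

lemma (in module) indep_family_mono: "indep_family I v \<Longrightarrow> J \<subseteq> I \<Longrightarrow> indep_family J v"
  unfolding indep_family_def by (meson image_mono independent_mono inj_on_subset)

lemma (in module) indep_family_cong: "(\<And>i. i \<in> I \<Longrightarrow> v i = w i) \<Longrightarrow> indep_family I v \<longleftrightarrow> indep_family I w"
  unfolding indep_family_def by (metis image_cong inj_on_cong)

lemma (in module) indep_family_reindex:
  assumes "bij_betw f J I"
  shows "indep_family J (\<lambda>j. v (f j)) \<longleftrightarrow> indep_family I v"
proof -
  have "f ` J = I" "inj_on f J" using assms by (auto simp: bij_betw_def)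
  then show ?thesis
    using comp_inj_on_iff[of f J v] by (auto simp: indep_family_def o_def image_image[symmetric])
qed

lemma (in module) indep_family_span_disjoint:
  assumes "indep_family I u" "finite I" "J \<subseteq> I" "K \<subseteq> I" "J \<inter> K = {}"
    and x: "x \<in> span (u ` J)" "x \<in> span (u ` K)"
  shows "x = 0"
proof -
  have fin: "finite J" "finite K" using assms by (auto intro: finite_subset)
  obtain b c where b: "x = (\<Sum>i\<in>J. b i *s u i)" and c: "x = (\<Sum>i\<in>K. c i *s u i)"
    using x fin by (metis span_familyE)
  define h where "h i = (if i \<in> J then b i else - c i)" for i
  have "(\<Sum>i\<in>J \<union> K. h i *s u i) = (\<Sum>i\<in>J. h i *s u i) + (\<Sum>i\<in>K. h i *s u i)"
    using fin assms by (intro sum.union_disjoint) auto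
  also have "(\<Sum>i\<in>J. h i *s u i) = x" by (simp add: b h_def)
  also have "(\<Sum>i\<in>K. h i *s u i) = (\<Sum>i\<in>K. - (c i *s u i))"
    using assms(5) by (intro sum.cong) (auto simp: h_def)
  also have "\<dots> = - x" by (simp add: c sum_negf)
  finally have "(\<Sum>i\<in>J \<union> K. h i *s u i) = 0" by simp
  moreover have "indep_family (J \<union> K) u" using assms by (intro indep_family_mono[OF assms(1)]) auto
  ultimately have "h i = 0" if "i \<in> J" for i
    using that fin by (intro indep_familyD[of "J \<union> K" u h]) auto
  then show ?thesis by (simp add: b h_def)
qed

text \<open>Steinitz exchange survives over any commutative ring if the replaced vector has a unit
  coefficient. It serves over k for the Bruhat decomposition and over W(k) for lifting
  bases.\<close>

lemma (in module) family_exchange: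
  assumes fin: "finite I" and z: "indep_family I z" and x: "x = (\<Sum>i\<in>I. c i *s z i)"
    and j: "j \<in> I" "c j dvd 1"
  shows "indep_family I (z(j := x))" "span ((z(j := x)) ` I) = span (z ` I)"
proof -
  obtain q where q: "1 = c j * q" using j(2) by (elim dvdE)
  let ?z = "z(j := x)"
  have split: "(\<Sum>i\<in>I. f i) = f j + (\<Sum>i\<in>I - {j}. f i)" for f :: "_ \<Rightarrow> 'b"
    using fin j(1) by (rule sum.remove)
  show "indep_family I ?z"
  proof (rule indep_familyI[OF fin])
    fix b i assume b: "(\<Sum>i\<in>I. b i *s ?z i) = 0" and i: "i \<in> I"
    have "(\<Sum>i\<in>I. (b j * c i + (if i = j then 0 else b i)) *s z i)
        = b j *s x + (\<Sum>i\<in>I. (if i = j then 0 else b i) *s z i)"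
      by (simp add: scale_left_distrib sum.distrib x scale_sum_right)
    also have "(\<Sum>i\<in>I. (if i = j then 0 else b i) *s z i) = (\<Sum>i\<in>I - {j}. b i *s ?z i)"
      by (subst split) (auto intro!: sum.cong)
    also have "b j *s x + \<dots> = (\<Sum>i\<in>I. b i *s ?z i)"
      using split[of "\<lambda>i. b i *s ?z i"] by simp
    finally have "(\<Sum>i\<in>I. (b j * c i + (if i = j then 0 else b i)) *s z i) = 0"
      by (simp only: b)
    note 0 = indep_familyD[OF z fin this]
    have "b j * c j = 0" using 0[OF j(1)] by simp
    then have "b j = 0" using q by (metis mult.assoc mult_1_right mult_zero_left)
    then show "b i = 0" using 0[OF i] by (auto split: if_splits)
  qed
  have xz: "x \<in> span (z ` I)" unfolding x by (rule sum_in_span)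
  have "q *s x = q *s (c j *s z j) + q *s (\<Sum>i\<in>I - {j}. c i *s z i)"
    unfolding x by (subst split) (simp add: scale_right_distrib)
  also have "q *s (c j *s z j) = z j" using q by (simp add: mult.commute)
  finally have "z j = q *s x - q *s (\<Sum>i\<in>I - {j}. c i *s ?z i)"
    by (simp add: fun_upd_def)
  moreover have "x \<in> span (?z ` I)" using j(1) by (auto intro!: span_base)
  moreover have "(\<Sum>i\<in>I - {j}. c i *s ?z i) \<in> span (?z ` I)"
    using sum_in_span span_mono[of "?z ` (I - {j})" "?z ` I"] by blast
  ultimately have "z j \<in> span (?z ` I)" by (simp add: span_diff span_scale)
  moreover have "z i \<in> span (?z ` I)" if "i \<in> I" "i \<noteq> j" for i
    using that by (intro span_base image_eqI[of _ _ i]) auto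
  ultimately have "z ` I \<subseteq> span (?z ` I)" by auto
  moreover have "?z ` I \<subseteq> span (z ` I)" using xz by (auto intro: span_base)
  ultimately show "span (?z ` I) = span (z ` I)" by (simp add: span_eq)
qed

lemma (in vector_space) indep_family_if_spanning:
  assumes "indep_family I u" "finite I" "u ` I \<subseteq> span (v ` I)"
  shows "indep_family I v"
proof -
  have "card (u ` I) = card I" using assms(1) by (auto simp: indep_family_def card_image)
  obtain B where B: "B \<subseteq> v ` I" "independent B" "v ` I \<subseteq> span B"
    using maximal_independent_subset by blast
  have finB: "finite B" using B(1) assms(2) by (meson finite_imageI finite_subset)
  have "u ` I \<subseteq> span B" using assms(3) B(3) by (meson span_minimal subspace_span order_trans)
  then have "card I \<le> card B"
    using independent_span_bound[OF finB, of "u ` I"] assms(1) \<open>card (u ` I) = card I\<close>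
    by (auto simp: indep_family_def)
  moreover have "card B \<le> card (v ` I)" using B(1) assms(2) by (intro card_mono) auto
  moreover have "card (v ` I) \<le> card I" using assms(2) by (rule card_image_le)
  ultimately have "card (v ` I) = card I" "B = v ` I"
    using card_subset_eq[OF finite_imageI[OF assms(2)] B(1)] by auto
  then show ?thesis using B(2) assms(2) by (simp add: indep_family_def eq_card_imp_inj_on)
qed

lemma (in vector_space) indep_family_spans:
  assumes v: "indep_family J v" and fin: "finite J" "finite K" "card K \<le> card J"
    and sub: "v ` J \<subseteq> span (u ` K)"
  shows "span (v ` J) = span (u ` K)"
proof (rule ccontr)
  assume ne: "span (v ` J) \<noteq> span (u ` K)"
  have le: "span (v ` J) \<subseteq> span (u ` K)" using sub by (simp add: span_minimal)
  with ne obtain x where x: "x \<in> span (u ` K)" "x \<notin> span (v ` J)" by blast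
  have ind: "independent (insert x (v ` J))"
    using x(2) v by (auto simp: indep_family_def independent_insertI)
  have "insert x (v ` J) \<subseteq> span (u ` K)" using x sub by auto
  from independent_span_bound[OF _ ind this] fin have "card (insert x (v ` J)) \<le> card (u ` K)" by auto
  also have "\<dots> \<le> card K" using fin by (intro card_image_le)
  also have "card (insert x (v ` J)) = Suc (card J)"
    using x(2) fin v by (subst card_insert_disjoint) (auto simp: indep_family_def card_image span_base)
  finally show False using fin by simp
qed

lemma (in vector_space) card_eq_if_span_eq:
  assumes "indep_family J v" "indep_family K u" "finite J" "finite K" "span (v ` J) = span (u ` K)"
  shows "card J = card K"
  using span_eq_dim[OF assms(5)] assms(1,2)
  by (simp add: indep_family_def dim_eq_card_independent card_image)

section \<open>Blockwise filtrations and their common bases\<close>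

text \<open>Indices carry a block \<open>a i\<close> and a level \<open>e i\<close>; filtrations are decreasing in the level,
  separately in each block. An increasing filtration is encoded by negated levels.\<close>

definition eqlev :: "'i set \<Rightarrow> ('i \<Rightarrow> 'l) \<Rightarrow> ('i \<Rightarrow> int) \<Rightarrow> 'i \<Rightarrow> 'i set" where
  "eqlev I a e i = {l \<in> I. a l = a i \<and> e l = e i}"

definition higher :: "'i set \<Rightarrow> ('i \<Rightarrow> 'l) \<Rightarrow> ('i \<Rightarrow> int) \<Rightarrow> 'i \<Rightarrow> 'i set" where
  "higher I a e i = {l \<in> I. a l = a i \<and> e l > e i}"

definition atleast :: "'i set \<Rightarrow> ('i \<Rightarrow> 'l) \<Rightarrow> ('i \<Rightarrow> int) \<Rightarrow> 'i \<Rightarrow> 'i set" where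
  "atleast I a e i = {l \<in> I. a l = a i \<and> e l \<ge> e i}"

lemma atleast_Un: "atleast I a e i = eqlev I a e i \<union> higher I a e i"
  by (auto simp: atleast_def eqlev_def higher_def)

lemma lev_subset: "eqlev I a e i \<subseteq> I" "higher I a e i \<subseteq> I" "atleast I a e i \<subseteq> I"
  "eqlev I a e i \<subseteq> atleast I a e i" "higher I a e i \<subseteq> atleast I a e i"
  by (auto simp: atleast_def eqlev_def higher_def)

lemma lev_mono: "l \<in> atleast I a e i \<Longrightarrow> atleast I a e l \<subseteq> atleast I a e i"
  "l \<in> higher I a e i \<Longrightarrow> atleast I a e l \<subseteq> higher I a e i"
  "l \<in> eqlev I a e i \<Longrightarrow> higher I a e l = higher I a e i"
  "l \<in> eqlev I a e i \<Longrightarrow> eqlev I a e l = eqlev I a e i"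
  by (auto simp: atleast_def eqlev_def higher_def)

text \<open>A unitriangular change of family can be inverted from the highest levels downwards, so
  \<open>z\<close> spans every \<open>y i\<close>; a dimension count then gives
  independence.\<close>

lemma (in vector_space) triangular_indep:
  assumes fin: "finite I" and y: "indep_family I y"
    and zy: "\<And>i. i \<in> I \<Longrightarrow> z i - y i \<in> span (y ` higher I a e i)"
  shows "indep_family I z"
proof -
  have "y i \<in> span (z ` I)" if "i \<in> I" for i
    using that
  proof (induction "card (higher I a e i)" arbitrary: i rule: less_induct)
    case less
    have "y l \<in> span (z ` I)" if l: "l \<in> higher I a e i" for l
    proof (rule less.hyps)
      have "higher I a e l \<subset> higher I a e i"
        using l by (auto simp: higher_def)
      then show "card (higher I a e l) < card (higher I a e i)"
        using fin lev_subset(2) by (metis psubset_card_mono finite_subset)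
      show "l \<in> I" using l by (auto simp: higher_def)
    qed
    then have "span (y ` higher I a e i) \<subseteq> span (z ` I)" by (intro span_minimal) auto
    then have "z i - y i \<in> span (z ` I)" using zy[OF less.prems] by auto
    moreover have "z i \<in> span (z ` I)" using less.prems by (auto intro: span_base)
    ultimately show ?case using span_diff by fastforce
  qed
  then show ?thesis using indep_family_if_spanning[OF y fin] by blast
qed

lemma (in vector_space) span_block_eq:
  assumes fin: "finite I" and z: "indep_family I z"
    and sub: "\<And>i. i \<in> J \<Longrightarrow> z i \<in> span (u ` J)" and J: "J \<subseteq> I"
  shows "span (z ` J) = span (u ` J)"
  using indep_family_spans[OF indep_family_mono[OF z J], of J u] sub finite_subset[OF J fin] by auto

text \<open>An index set closed under higher levels within a block contains \<open>atleast\<close>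
  of each of its members. On such a set \<open>z\<close> stays in the span of \<open>u\<close>, and
  independence with equal cardinality forces equality: \<open>z\<close> is adapted to the filtration
  defined by \<open>u\<close>.\<close>

lemma (in vector_space) span_atleast_eq:
  assumes fin: "finite I" and z: "indep_family I z"
    and zu: "\<And>i. i \<in> I \<Longrightarrow> z i \<in> span (u ` atleast I a e i)"
  shows "i \<in> I \<Longrightarrow> span (z ` atleast I a e i) = span (u ` atleast I a e i)"
    and "i \<in> I \<Longrightarrow> span (z ` higher I a e i) = span (u ` higher I a e i)"
    and "span (z ` {i \<in> I. a i = s}) = span (u ` {i \<in> I. a i = s})"
proof -
  have m: "z l \<in> span (u ` J)" if "l \<in> I" "atleast I a e l \<subseteq> J" for l J
    using zu[OF that(1)] span_mono[OF image_mono[OF that(2)], of u] by auto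
  show "span (z ` atleast I a e i) = span (u ` atleast I a e i)" if "i \<in> I"
    by (intro span_block_eq[OF fin z] m) (auto simp: atleast_def higher_def)
  show "span (z ` higher I a e i) = span (u ` higher I a e i)" if "i \<in> I"
    by (intro span_block_eq[OF fin z] m) (auto simp: atleast_def higher_def)
  show "span (z ` {i \<in> I. a i = s}) = span (u ` {i \<in> I. a i = s})"
    by (intro span_block_eq[OF fin z] m) (auto simp: atleast_def)
qed

text \<open>An adapted basis induces bases of the graded pieces, and \<open>u\<close> splits the
  filtration, identifying each piece with a span of vectors of equal level. There the classes of
  \<open>z\<close> become the vectors \<open>y\<close>.\<close>

lemma (in vector_space) leading_terms_indep:
  assumes fin: "finite I" and u: "indep_family I u" and z: "indep_family I z"
    and y: "\<And>i. i \<in> I \<Longrightarrow> y i \<in> span (u ` eqlev I a e i)"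
    and zy: "\<And>i. i \<in> I \<Longrightarrow> z i - y i \<in> span (u ` higher I a e i)"
  shows "indep_family I y"
proof -
  have zu: "z i \<in> span (u ` atleast I a e i)" if "i \<in> I" for i
  proof -
    have "y i \<in> span (u ` atleast I a e i)" "z i - y i \<in> span (u ` atleast I a e i)"
      using y[OF that] zy[OF that] by (auto intro: span_family_mono[OF _ lev_subset(4)] span_family_mono[OF _ lev_subset(5)])
    from span_add[OF this] show ?thesis by simp
  qed
  have "u m \<in> span (y ` I)" if m: "m \<in> I" for m
  proof -
    have sp: "span (z ` atleast I a e m) = span (u ` atleast I a e m)"
      using m zu by (intro span_atleast_eq(1)[OF fin z])
    have sp': "span (z ` higher I a e m) = span (u ` higher I a e m)"
      using m zu by (intro span_atleast_eq(2)[OF fin z])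
    have finl: "finite (atleast I a e m)" "finite (eqlev I a e m)" "finite (higher I a e m)"
      using fin lev_subset by (metis finite_subset)+
    have "m \<in> eqlev I a e m" using m by (simp add: eqlev_def)
    then have um: "u m \<in> span (u ` eqlev I a e m)" by (auto intro: span_base)
    have "u m \<in> span (z ` atleast I a e m)"
      unfolding sp using m by (auto intro!: span_base simp: atleast_def)
    then obtain c where c: "u m = (\<Sum>l\<in>atleast I a e m. c l *s z l)"
      using finl(1) by (auto elim: span_familyE)
    define s where "s = (\<Sum>l\<in>eqlev I a e m. c l *s y l)"
    have s: "s \<in> span (u ` eqlev I a e m)"
      unfolding s_def
    proof (intro span_sum span_scale)
      fix l assume "l \<in> eqlev I a e m"
      then show "y l \<in> span (u ` eqlev I a e m)"
        using y[of l] by (auto simp: eqlev_def)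
    qed
    have "u m = (\<Sum>l\<in>eqlev I a e m. c l *s z l) + (\<Sum>l\<in>higher I a e m. c l *s z l)"
      unfolding c atleast_Un using finl
      by (intro sum.union_disjoint) (auto simp: eqlev_def higher_def)
    then have "u m - s = (\<Sum>l\<in>eqlev I a e m. c l *s (z l - y l)) + (\<Sum>l\<in>higher I a e m. c l *s z l)"
      by (simp add: s_def scale_right_diff_distrib sum_subtractf)
    moreover have "(\<Sum>l\<in>higher I a e m. c l *s z l) \<in> span (u ` higher I a e m)"
      unfolding sp'[symmetric] by (rule sum_in_span)
    moreover have "(\<Sum>l\<in>eqlev I a e m. c l *s (z l - y l)) \<in> span (u ` higher I a e m)"
    proof (intro span_sum span_scale)
      fix l assume "l \<in> eqlev I a e m"
      then show "z l - y l \<in> span (u ` higher I a e m)"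
        using zy[of l] lev_mono(3)[of l I a e m] by (auto simp: eqlev_def)
    qed
    ultimately have "u m - s \<in> span (u ` higher I a e m)" by (simp add: span_add)
    moreover have "u m - s \<in> span (u ` eqlev I a e m)" using um s by (rule span_diff)
    moreover have "eqlev I a e m \<inter> higher I a e m = {}" by (auto simp: eqlev_def higher_def)
    ultimately have "u m - s = 0"
      using indep_family_span_disjoint[OF u fin lev_subset(1) lev_subset(2)] by blast
    then have "u m = s" by simp
    moreover have "s \<in> span (y ` I)"
      unfolding s_def using sum_in_span by (rule span_family_mono) (rule lev_subset)
    ultimately show ?thesis by simp
  qed
  then show ?thesis using indep_family_if_spanning[OF u fin] by blast
qed

text \<open>The Bruhat decomposition. The \<open>w i\<close> are inserted in the order of decreasing level: \<open>w j\<close>,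
  reduced modulo the vectors already inserted, replaces a vector of lowest level in its expansion.\<close>

lemma (in vector_space) common_adapted_basis:
  assumes fin: "finite I" and u: "indep_family I u" and w: "indep_family I w"
    and blocks: "\<And>s. span (u ` {i \<in> I. a i = s}) = span (w ` {i \<in> I. a' i = s})"
  shows "\<exists>t \<omega>. \<omega> permutes I \<and> indep_family I t \<and> (\<forall>i\<in>I. t i \<in> span (u ` atleast I a e i) \<and>
    t (\<omega> i) \<in> span (w ` atleast I a' d i) \<and> a (\<omega> i) = a' i)"
proof -
  have "J \<subseteq> I \<Longrightarrow> \<exists>t \<omega>. indep_family I t \<and> (\<forall>i\<in>I. t i \<in> span (u ` atleast I a e i)) \<and> inj_on \<omega> J \<and>
      (\<forall>j\<in>J. \<omega> j \<in> I \<and> a (\<omega> j) = a' j \<and> t (\<omega> j) \<in> span (w ` atleast J a' d j))"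
    if "finite J" for J
    using that
  proof (induction J rule: finite_ranking_induct[where f = "\<lambda>j. - d j"])
    case empty
    have "u i \<in> span (u ` atleast I a e i)" if "i \<in> I" for i
      using that by (auto intro!: span_base simp: atleast_def)
    then show ?case using u by auto
  next
    case (insert j J)
    show ?case
    proof (cases "j \<in> J")
      case True
      then show ?thesis using insert by (simp add: insert_absorb)
    next
      case False
      from insert obtain t \<omega> where t: "indep_family I t" and tu: "\<And>i. i \<in> I \<Longrightarrow> t i \<in> span (u ` atleast I a e i)"
        and inj: "inj_on \<omega> J" and \<omega>: "\<And>l. l \<in> J \<Longrightarrow> \<omega> l \<in> I \<and> a (\<omega> l) = a' l"
        and tw: "\<And>l. l \<in> J \<Longrightarrow> t (\<omega> l) \<in> span (w ` atleast J a' d l)"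
        by auto
      have jI: "j \<in> I" and JI: "J \<subseteq> I" using insert.prems by auto
      let ?B = "{i \<in> I. a i = a' j}"
      have "w j \<in> span (w ` {i \<in> I. a' i = a' j})" using jI by (auto intro: span_base)
      also have "\<dots> = span (t ` ?B)"
        using span_atleast_eq(3)[OF fin t tu] blocks by simp
      finally obtain c where c: "w j = (\<Sum>i\<in>?B. c i *s t i)"
        using fin by (auto elim: span_familyE)
      define x where "x = (\<Sum>i\<in>?B - \<omega> ` J. c i *s t i)"
      define r where "r = (\<Sum>i\<in>?B \<inter> \<omega> ` J. c i *s t i)"
      have wj: "w j = x + r"
        unfolding c x_def r_def using fin by (subst sum.Int_Diff[of _ _ "\<omega> ` J"]) auto
      have r: "r \<in> span (w ` {l \<in> J. a' l = a' j})"
        unfolding r_def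
      proof (intro span_sum span_scale)
        fix i assume "i \<in> ?B \<inter> \<omega> ` J"
        then obtain l where l: "l \<in> J" "i = \<omega> l" "a i = a' j" by auto
        then have "atleast J a' d l \<subseteq> {l \<in> J. a' l = a' j}" using \<omega> by (auto simp: atleast_def)
        from span_mono[OF image_mono[OF this], of w] tw[OF l(1)] l
        show "t i \<in> span (w ` {l \<in> J. a' l = a' j})" by auto
      qed
      have "{l \<in> J. a' l = a' j} \<subseteq> atleast (Set.insert j J) a' d j"
        using insert.hyps by (auto simp: atleast_def)
      from span_mono[OF image_mono[OF this], of w] r
      have "r \<in> span (w ` atleast (Set.insert j J) a' d j)" by auto
      moreover have "w j \<in> span (w ` atleast (Set.insert j J) a' d j)"
        by (auto intro!: span_base simp: atleast_def)
      ultimately have xw: "x \<in> span (w ` atleast (Set.insert j J) a' d j)"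
        using wj span_diff[of "w j" _ r] by simp
      have "x \<noteq> 0"
      proof
        assume "x = 0"
        then have "w j \<in> span (w ` J)"
          using r wj span_mono[OF image_mono, of "{l \<in> J. a' l = a' j}" J w] by auto
        then have "w j = 0"
          using indep_family_span_disjoint[OF w fin, of "{j}" J "w j"] jI JI False by (auto intro: span_base)
        then show False
          using w jI dependent_zero[of "w ` I"] by (force simp: indep_family_def)
      qed
      define K where "K = {i \<in> ?B - \<omega> ` J. c i \<noteq> 0}"
      have "K \<noteq> {}"
      proof
        assume "K = {}"
        then have "x = 0" unfolding x_def K_def by (intro sum.neutral) auto
        then show False using \<open>x \<noteq> 0\<close> by simp
      qed
      have finK: "finite K" using fin by (simp add: K_def)
      \<comment> \<open>Minimality of the level keeps \<open>x\<close> inside the step of the first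
        filtration that belongs to \<open>k\<close>, so the new basis is still adapted to it; taking
        \<open>k\<close> outside the image of \<open>J\<close> protects the vectors already
        placed.\<close>
      define k where "k = arg_min_on e K"
      have k: "k \<in> K" "\<And>i. i \<in> K \<Longrightarrow> e k \<le> e i"
        using arg_min_if_finite[OF finK \<open>K \<noteq> {}\<close>, of e] by (auto simp: k_def not_less)
      have kI: "k \<in> I" "a k = a' j" "k \<notin> \<omega> ` J" "c k \<noteq> 0" using k(1) by (auto simp: K_def)
      have xu: "x \<in> span (u ` atleast I a e k)"
        unfolding x_def
      proof (intro span_sum)
        fix i assume i: "i \<in> ?B - \<omega> ` J"
        show "c i *s t i \<in> span (u ` atleast I a e k)"
        proof (cases "c i = 0")
          case False
          then have "i \<in> K" using i by (simp add: K_def)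
          then have "atleast I a e i \<subseteq> atleast I a e k"
            using k(2)[of i] kI by (auto simp: atleast_def K_def)
          then show ?thesis
            using tu[of i] i span_mono[OF image_mono, of _ _ u] by (intro span_scale) blast
        qed (simp add: span_zero)
      qed
      have "x = (\<Sum>i\<in>I. (if i \<in> ?B - \<omega> ` J then c i else 0) *s t i)"
        unfolding x_def using fin by (intro sum.mono_neutral_cong_left) auto
      from family_exchange(1)[OF fin t this kI(1)] kI
      have t': "indep_family I (t(k := x))" by (simp add: dvd_field_iff)
      show ?thesis
      proof (intro exI conjI ballI)
        show "indep_family I (t(k := x))" by fact
        show "(t(k := x)) i \<in> span (u ` atleast I a e i)" if "i \<in> I" for i
          using that tu xu by auto
        show "inj_on (\<omega>(j := k)) (Set.insert j J)"
          using inj kI False by (auto simp: inj_on_def)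
        fix l assume l: "l \<in> Set.insert j J"
        show "(\<omega>(j := k)) l \<in> I" "a ((\<omega>(j := k)) l) = a' l" using l \<omega> kI by auto
        have "atleast J a' d l \<subseteq> atleast (Set.insert j J) a' d l" by (auto simp: atleast_def)
        then have "t (\<omega> l) \<in> span (w ` atleast (Set.insert j J) a' d l)" if "l \<in> J"
          using tw[OF that] span_mono[OF image_mono, of _ _ w] by blast
        moreover have "\<omega> l \<noteq> k" if "l \<in> J" using that kI by auto
        ultimately show "(t(k := x)) ((\<omega>(j := k)) l) \<in> span (w ` atleast (Set.insert j J) a' d l)"
          using l xw by auto
      qed
    qed
  qed
  from this[OF fin order_refl] obtain t \<omega> where t: "indep_family I t"
    "\<And>i. i \<in> I \<Longrightarrow> t i \<in> span (u ` atleast I a e i)" "inj_on \<omega> I"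
    "\<And>j. j \<in> I \<Longrightarrow> \<omega> j \<in> I \<and> a (\<omega> j) = a' j \<and> t (\<omega> j) \<in> span (w ` atleast I a' d j)"
    by blast
  define \<omega>' where "\<omega>' i = (if i \<in> I then \<omega> i else i)" for i
  have "bij_betw \<omega> I I" using t fin by (simp add: bij_betw_def endo_inj_surj image_subset_iff)
  then have "\<omega>' permutes I"
    by (intro bij_imp_permutes) (auto simp: \<omega>'_def cong: bij_betw_cong)
  then show ?thesis using t by (intro exI[of _ t] exI[of _ \<omega>']) (auto simp: \<omega>'_def)
qed

section \<open>Semilinear maps\<close>

text \<open>The exponent is a parameter because iterates of a p-semilinear map are p^n-semilinear,
  and Lang's theorem will be applied to such iterates.\<close>

definition (in vector_space) semilin :: "nat \<Rightarrow> ('b \<Rightarrow> 'b) \<Rightarrow> bool" where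
  "semilin q F \<longleftrightarrow> (\<forall>x y. F (x + y) = F x + F y) \<and> (\<forall>c x. F (c *s x) = c ^ q *s F x)"

lemma (in vector_space) semilin_add: "semilin q F \<Longrightarrow> F (x + y) = F x + F y"
  and semilin_scale: "semilin q F \<Longrightarrow> F (c *s x) = c ^ q *s F x"
  by (simp_all add: semilin_def)

lemma (in vector_space) semilin_0: "semilin q F \<Longrightarrow> F 0 = 0"
  using semilin_add[of q F 0 0] by simp

lemma (in vector_space) semilin_diff: "semilin q F \<Longrightarrow> F (x - y) = F x - F y"
  using semilin_add[of q F "x - y" y] by simp

lemma (in vector_space) semilin_sum: "semilin q F \<Longrightarrow> F (\<Sum>i\<in>J. c i *s v i) = (\<Sum>i\<in>J. c i ^ q *s F (v i))"
  by (induction J rule: infinite_finite_induct) (simp_all add: semilin_0 semilin_add semilin_scale)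

lemma (in vector_space) semilin_funpow: "semilin q F \<Longrightarrow> semilin (q ^ n) (F ^^ n)"
  by (induction n) (simp_all add: semilin_def power_mult mult.commute[of _ "q ^ _"] flip: power_mult)

lemma (in vector_space) semilin_span:
  assumes "semilin q F" "x \<in> span S"
  shows "F x \<in> span (F ` S)"
  using assms(2)
proof (induction rule: span_induct_alt)
  case (step c x y)
  then show ?case
    using assms(1) by (simp add: semilin_add semilin_scale span_add span_scale span_base)
qed (simp add: semilin_0[OF assms(1)] span_zero)

lemma (in vector_space) semilin_inj_on:
  assumes F: "semilin q F" and fin: "finite I" and w: "indep_family I (\<lambda>i. F (u i))" and "q > 0"
  shows "inj_on F (span (u ` I))"
proof (rule inj_onI)
  fix x y assume xy: "x \<in> span (u ` I)" "y \<in> span (u ` I)" "F x = F y"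
  then have "x - y \<in> span (u ` I)" by (intro span_diff)
  then obtain c where c: "x - y = (\<Sum>i\<in>I. c i *s u i)" using fin by (auto elim: span_familyE)
  have "F (x - y) = 0" using xy(3) F by (simp add: semilin_diff)
  then have "(\<Sum>i\<in>I. c i ^ q *s F (u i)) = 0" by (simp add: c semilin_sum[OF F])
  from indep_familyD[OF w fin this] have "c i ^ q = 0" if "i \<in> I" for i using that by simp
  then have "x - y = 0" unfolding c using \<open>q > 0\<close> by (intro sum.neutral) auto
  then show "x = y" by simp
qed

lemma (in vector_space) indep_family_if_semilin_image:
  assumes F: "semilin q F" and fin: "finite I" and w: "indep_family I (\<lambda>i. F (u i))" and q: "q > 0"
  shows "indep_family I u"
proof (rule indep_familyI[OF fin])
  fix c i assume "(\<Sum>i\<in>I. c i *s u i) = 0" and i: "i \<in> I"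
  then have "(\<Sum>i\<in>I. c i ^ q *s F (u i)) = 0" using semilin_sum[OF F, of c u I] semilin_0[OF F] by simp
  from indep_familyD[OF w fin this i] show "c i = 0" using q by simp
qed

section \<open>Lang's theorem\<close>

locale acf_space = vector_space scale
  for scale :: "'k::alg_closed_field \<Rightarrow> 'v::ab_group_add \<Rightarrow> 'v" (infixr \<open>*s\<close> 75)

text \<open>Coefficients have q-th roots in k, so the image of a span is the whole span of the
  images, as for a linear map.\<close>

lemma (in acf_space) semilin_preimage:
  assumes F: "semilin q F" and fin: "finite J" and "q > 0" and x: "x \<in> span ((\<lambda>i. F (u i)) ` J)"
  obtains y where "y \<in> span (u ` J)" "F y = x"
proof -
  obtain c where c: "x = (\<Sum>i\<in>J. c i *s F (u i))" using x fin by (auto elim: span_familyE)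
  obtain R :: "'k \<Rightarrow> 'k" where R: "\<And>x. R x ^ q = x"
    using nth_root_exists[OF \<open>q > 0\<close>] by metis
  show ?thesis
  proof (rule that)
    show "(\<Sum>i\<in>J. R (c i) *s u i) \<in> span (u ` J)" by (rule sum_in_span)
    show "F (\<Sum>i\<in>J. R (c i) *s u i) = x" by (simp add: semilin_sum[OF F] R c)
  qed
qed

lemma artin_schreier_root:
  fixes b :: "'k::alg_closed_field"
  assumes "q \<ge> 2"
  shows "\<exists>r. b + r ^ q = r"
proof -
  define P :: "'k poly" where "P = monom 1 q + [:b, -1:]"
  have "degree P = q"
    unfolding P_def using assms by (subst degree_add_eq_left) (auto simp: degree_monom_eq)
  then obtain r where "poly P r = 0" using alg_closed_imp_poly_has_root[of P] assms by auto
  then have "b + r ^ q = r" by (simp add: P_def poly_monom algebra_simps)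
  then show ?thesis ..
qed

text \<open>The coefficients of a solution \<open>\<Sum>\<^sub>i c\<^sub>i F\<^sup>i x\<close> of \<open>F y = y\<close>, given \<open>F\<^sup>n x = \<Sum>\<^sub>i a\<^sub>i F\<^sup>i x\<close>,
  in terms of \<open>z = c\<^sub>n\<^sub>-\<^sub>1\<close>.\<close>

fun lang_coeff :: "nat \<Rightarrow> (nat \<Rightarrow> 'k::comm_ring_1) \<Rightarrow> 'k \<Rightarrow> nat \<Rightarrow> 'k" where
  "lang_coeff q a z 0 = a 0 * z ^ q"
| "lang_coeff q a z (Suc i) = lang_coeff q a z i ^ q + a (Suc i) * z ^ q"

text \<open>Each coefficient has the form z^q Q(z), with Q nonzero as soon as some
  \<open>a i\<close> up to that index is nonzero. Dividing by z turns the equation into z^(q-1) Q(z)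
  = 1, which has positive degree since q is at least 2 and whose roots are automatically
  nonzero.\<close>

lemma lang_coeff_fixed_point:
  fixes a :: "nat \<Rightarrow> 'k::alg_closed_field"
  assumes q: "q \<ge> 2" and a: "i \<le> n" "a i \<noteq> 0"
  shows "\<exists>z. z \<noteq> 0 \<and> lang_coeff q a z n = z"
proof -
  have "\<exists>Q :: 'k poly. (\<forall>z. lang_coeff q a z m = z ^ q * poly Q z) \<and> ((\<exists>i\<le>m. a i \<noteq> 0) \<longrightarrow> Q \<noteq> 0)" for m
  proof (induction m)
    case 0
    show ?case by (intro exI[of _ "[:a 0:]"]) auto
  next
    case (Suc m)
    then obtain Q :: "'k poly" where Q: "\<And>z. lang_coeff q a z m = z ^ q * poly Q z"
      "(\<exists>i\<le>m. a i \<noteq> 0) \<Longrightarrow> Q \<noteq> 0" by blast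
    define Q' where "Q' = monom 1 (q * (q - 1)) * Q ^ q + [:a (Suc m):]"
    have "q * q = q + q * (q - 1)" using q by (cases q) auto
    then have "lang_coeff q a z (Suc m) = z ^ q * poly Q' z" for z
      by (simp add: Q Q'_def poly_monom power_mult_distrib algebra_simps flip: power_mult power_add)
    moreover have "Q' \<noteq> 0" if "\<exists>i\<le>Suc m. a i \<noteq> 0"
    proof (cases "a (Suc m) = 0")
      case True
      then have "Q \<noteq> 0" using that Q(2) by (metis le_Suc_eq)
      then show ?thesis using True by (simp add: Q'_def)
    next
      case False
      have "poly Q' 0 = a (Suc m)" using q by (simp add: Q'_def poly_monom power_0_left)
      then show ?thesis using False by auto
    qed
    ultimately show ?case by blast
  qed
  then obtain Q :: "'k poly" where Q: "\<And>z. lang_coeff q a z n = z ^ q * poly Q z" "Q \<noteq> 0"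
    using a by blast
  define P where "P = monom 1 (q - 1) * Q - 1"
  have "degree (monom 1 (q - 1) * Q) = (q - 1) + degree Q"
    using Q(2) by (subst degree_mult_eq) (auto simp: degree_monom_eq)
  moreover have "degree (monom 1 (q - 1) * Q) \<le> max (degree P) (degree (1 :: 'k poly))"
    using degree_add_le_max[of P 1] by (simp add: P_def)
  ultimately have "degree P > 0" using q by auto
  then obtain z where z: "poly P z = 0" using alg_closed_imp_poly_has_root by blast
  then have 1: "z ^ (q - 1) * poly Q z = 1" by (simp add: P_def poly_monom)
  have "z ^ q = z * z ^ (q - 1)" using q by (cases q) auto
  then have "lang_coeff q a z n = z" using 1 by (simp add: Q mult.assoc)
  moreover have "z \<noteq> 0" using 1 q by (auto simp: power_0_left)
  ultimately show ?thesis by blast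
qed

text \<open>For \<open>x\<close> outside the span of the fixed vectors, the first dependence among
  its iterates modulo that span yields another fixed vector. The last iterate occurring in that
  vector has a nonzero coefficient, which gives a still earlier dependence, a contradiction.\<close>

theorem (in acf_space) lang:
  assumes F: "semilin q F" and q: "q \<ge> 2" and fin: "finite B"
    and U: "\<And>x. x \<in> span B \<Longrightarrow> F x \<in> span B" and inj: "inj_on F (span B)"
  shows "span B \<subseteq> span {x \<in> span B. F x = x}"
proof (rule ccontr)
  define S where "S = {x \<in> span B. F x = x}"
  assume "\<not> span B \<subseteq> span {x \<in> span B. F x = x}"
  then obtain x where x: "x \<in> span B" "x \<notin> span S" by (auto simp: S_def)
  have SB: "span S \<subseteq> span B" by (rule span_minimal) (auto simp: S_def)
  \<comment> \<open>On the span of the fixed vectors 1 - F is onto: coordinates with respect to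
    fixed vectors turn the equation into Artin-Schreier equations.\<close>
  have absorb: "\<exists>r\<in>span S. t + F r = r" if "t \<in> span S" for t
    using that
  proof (induction rule: span_induct_alt)
    case base
    show ?case using semilin_0[OF F] by (intro bexI[of _ 0]) (auto simp: span_zero)
  next
    case (step c s t)
    then obtain r where r: "r \<in> span S" "t + F r = r" by blast
    obtain \<rho> where \<rho>: "c + \<rho> ^ q = \<rho>" using artin_schreier_root[OF q] by blast
    have "(c *s s + t) + F (\<rho> *s s + r) = (c + \<rho> ^ q) *s s + (t + F r)"
      using F step.hyps by (simp add: semilin_add[OF F] semilin_scale[OF F] S_def scale_left_distrib algebra_simps)
    then show ?case
      using r \<rho> step.hyps by (intro bexI[of _ "\<rho> *s s + r"]) (auto intro: span_add span_scale span_base)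
  qed
  have surj: "\<exists>r\<in>span S. F r = t" if "t \<in> span S" for t
    using that
  proof (induction rule: span_induct_alt)
    case base
    show ?case using semilin_0[OF F] by (intro bexI[of _ 0]) (auto simp: span_zero)
  next
    case (step c s t)
    then obtain r where r: "r \<in> span S" "F r = t" by blast
    obtain \<rho> where \<rho>: "\<rho> ^ q = c" using nth_root_exists[of q c] q by auto
    have "F (\<rho> *s s + r) = c *s s + t"
      using F step.hyps r \<rho> by (simp add: semilin_add[OF F] semilin_scale[OF F] S_def)
    then show ?case
      using r step.hyps by (intro bexI[of _ "\<rho> *s s + r"]) (auto intro: span_add span_scale span_base)
  qed
  \<comment> \<open>F already maps the span of \<open>S\<close> onto itself, so by injectivity no
    other vector is mapped into it.\<close>
  have pull: "y \<in> span S" if y: "y \<in> span B" "F y \<in> span S" for y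
  proof -
    obtain r where r: "r \<in> span S" "F r = F y" using surj[OF y(2)] by blast
    then have "r = y" using inj_onD[OF inj _ _ y(1)] SB by blast
    with r show ?thesis by simp
  qed
  define g where "g k = (F ^^ k) x" for k
  have gB: "g k \<in> span B" for k by (induction k) (auto simp: g_def x U)
  have Fg: "F (g k) = g (Suc k)" for k by (simp add: g_def)
  let ?dep = "\<lambda>n. g n \<in> span (g ` {..<n} \<union> S)"
  have "\<exists>n. ?dep n"
  proof (rule ccontr)
    assume no: "\<nexists>n. ?dep n"
    have indep: "independent (g ` {..<n}) \<and> card (g ` {..<n}) = n" for n
    proof (induction n)
      case (Suc n)
      have "g n \<notin> span (g ` {..<n})" using no span_mono[of "g ` {..<n}" "g ` {..<n} \<union> S"] by blast
      moreover from this have "g n \<notin> g ` {..<n}" using span_base[of "g n" "g ` {..<n}"] by auto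
      ultimately show ?case using Suc by (simp add: lessThan_Suc independent_insertI)
    qed (simp add: independent_empty)
    have "g ` {..<Suc (card B)} \<subseteq> span B" using gB by auto
    then show False
      using independent_span_bound[OF fin conjunct1[OF indep[of "Suc (card B)"]]] indep[of "Suc (card B)"] by simp
  qed
  define n where "n = (LEAST n. ?dep n)"
  have n: "?dep n" unfolding n_def using \<open>\<exists>n. ?dep n\<close> by (rule LeastI_ex)
  have least: "\<not> ?dep m" if "m < n" for m using that unfolding n_def by (rule not_less_Least)
  have "n \<noteq> 0"
  proof
    assume "n = 0"
    with n x show False by (simp add: g_def)
  qed
  then obtain m where m: "n = Suc m" by (cases n) auto
  from n obtain t h where t: "t \<in> span S" and h: "h \<in> span (g ` {..<n})" "g n = h + t"
    by (auto simp: span_Un)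
  obtain a where a: "h = (\<Sum>i<n. a i *s g i)" using h(1) by (auto elim: span_familyE)
  show False
  proof (cases "\<exists>i\<le>m. a i \<noteq> 0")
    case False
    then have "h = 0" unfolding a m by (intro sum.neutral) auto
    then have "F (g m) = t" by (simp add: Fg h(2) flip: m)
    then have "g m \<in> span S" using t gB by (auto intro!: pull[of "g m"])
    then have "?dep m" using span_mono[of S "g ` {..<m} \<union> S"] by blast
    then show False using least m by simp
  next
    case True
    then obtain z where z: "z \<noteq> 0" "lang_coeff q a z m = z" using lang_coeff_fixed_point[OF q] by blast
    let ?c = "lang_coeff q a z"
    \<comment> \<open>This vector is fixed only up to the error \<open>z ^ q *s t\<close>, which
      lies in the span of \<open>S\<close> and is removed by \<open>absorb\<close>.\<close>
    define y where "y = (\<Sum>i<n. ?c i *s g i)"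
    have "F y = (\<Sum>i<m. ?c i ^ q *s g (Suc i)) + z ^ q *s g n"
      unfolding y_def semilin_sum[OF F] Fg by (simp add: m z(2))
    also have "z ^ q *s g n = (\<Sum>i<n. (a i * z ^ q) *s g i) + z ^ q *s t"
      by (simp add: h(2) a scale_right_distrib scale_sum_right mult.commute)
    also have "(\<Sum>i<n. (a i * z ^ q) *s g i)
        = (a 0 * z ^ q) *s g 0 + (\<Sum>i<m. (a (Suc i) * z ^ q) *s g (Suc i))"
      unfolding m by (rule sum.lessThan_Suc_shift)
    also have "(\<Sum>i<m. ?c i ^ q *s g (Suc i)) + (\<dots> + z ^ q *s t)
        = (?c 0 *s g 0 + (\<Sum>i<m. ?c (Suc i) *s g (Suc i))) + z ^ q *s t"
      by (simp add: scale_left_distrib sum.distrib algebra_simps)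
    also have "?c 0 *s g 0 + (\<Sum>i<m. ?c (Suc i) *s g (Suc i)) = y"
      unfolding y_def m by (rule sum.lessThan_Suc_shift[symmetric])
    finally have Fy: "F y = y + z ^ q *s t" .
    obtain r where r: "r \<in> span S" "z ^ q *s t + F r = r" using absorb[OF span_scale[OF t]] by blast
    have "F (y + r) = y + r" using Fy r(2) by (simp add: semilin_add[OF F] add.assoc)
    moreover have "y + r \<in> span B"
      using r SB gB unfolding y_def by (intro span_add span_sum span_scale) auto
    ultimately have "y + r \<in> span S" by (intro span_base) (auto simp: S_def)
    then have "y \<in> span S" using span_diff[OF _ r(1), of "y + r"] by simp
    then have "y \<in> span (g ` {..<m} \<union> S)" using span_mono[of S "g ` {..<m} \<union> S"] by blast
    moreover have "(\<Sum>i<m. ?c i *s g i) \<in> span (g ` {..<m} \<union> S)"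
      by (intro span_sum span_scale span_base) auto
    moreover have "y = (\<Sum>i<m. ?c i *s g i) + z *s g m" by (simp add: y_def m z(2))
    ultimately have "z *s g m \<in> span (g ` {..<m} \<union> S)"
      using span_diff[of y _ "\<Sum>i<m. ?c i *s g i"] by simp
    from span_scale[OF this, of "inverse z"] have "?dep m" using z(1) by simp
    then show False using least m by simp
  qed
qed

text \<open>If \<open>F\<close> permutes the blocks, Lang's theorem for the first return of \<open>F\<close> to one block in each
  cycle gives a basis of that block, which \<open>F\<close> spreads over the cycle.\<close>

theorem (in acf_space) permuted_blocks_basis:
  fixes a a' :: "'i \<Rightarrow> 'l"
  assumes F: "semilin q F" and q: "q \<ge> 2" and fin: "finite I"
    and u: "indep_family I u" and w: "indep_family I (\<lambda>i. F (u i))"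
    and blocks: "\<And>s. span (u ` {i \<in> I. a i = s}) = span ((\<lambda>i. F (u i)) ` {i \<in> I. a' i = s})"
    and compat: "\<And>i j. i \<in> I \<Longrightarrow> j \<in> I \<Longrightarrow> a i = a j \<Longrightarrow> a' i = a' j"
  shows "\<exists>v \<pi>. \<pi> permutes I \<and> indep_family I v \<and>
    (\<forall>i\<in>I. v i \<in> span (u ` {l \<in> I. a l = a i}) \<and> v (\<pi> i) = F (v i) \<and> a (\<pi> i) = a' i)"
proof -

  \<comment> \<open>The permutation of the blocks\<close>
  define S where "S = a ` I"
  define B where "B s = {i \<in> I. a i = s}" for s
  define V where "V s = span (u ` B s)" for s
  have finS: "finite S" and finB: "finite (B s)" for s using fin by (auto simp: S_def B_def)
  have cardB: "card (B s) = card {i \<in> I. a' i = s}" for s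
    unfolding B_def using blocks[of s] fin indep_family_mono[OF u] indep_family_mono[OF w]
    by (intro card_eq_if_span_eq) auto
  have Bempty: "B s = {} \<longleftrightarrow> {i \<in> I. a' i = s} = {}" for s
  proof -
    have "finite {i \<in> I. a' i = s}" using fin by simp
    from card_0_eq[OF this] card_0_eq[OF finB[of s]] show ?thesis by (simp only: cardB)
  qed
  \<comment> \<open>F maps the block \<open>s\<close> into the block \<open>f s\<close>;
    \<open>compat\<close> makes this independent of the chosen index. Equal dimensions show that no
    block is missed, so \<open>f\<close> permutes the finite set \<open>S\<close>.\<close>
  define f where "f s = (if s \<in> S then a' (inv_into I a s) else s)" for s
  have fa: "f (a i) = a' i" if "i \<in> I" for i
    using that compat[of "inv_into I a (a i)" i]
    by (auto simp: f_def S_def inv_into_into f_inv_into_f)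
  have a'S: "f ` S = S"
  proof (intro set_eqI iffI)
    fix s assume "s \<in> f ` S"
    then obtain i where "i \<in> I" "s = a' i" using fa by (auto simp: S_def)
    then have "{i \<in> I. a' i = s} \<noteq> {}" by auto
    then have "B s \<noteq> {}" by (simp only: Bempty not_False_eq_True)
    then show "s \<in> S" by (auto simp: B_def S_def)
  next
    fix s assume "s \<in> S"
    then have "B s \<noteq> {}" by (auto simp: B_def S_def)
    then have "{i \<in> I. a' i = s} \<noteq> {}" by (simp only: Bempty not_False_eq_True)
    then obtain i where i: "i \<in> I" "a' i = s" by auto
    then have "s = f (a i)" by (simp add: fa)
    then show "s \<in> f ` S" using i by (simp add: S_def)
  qed
  then have injf: "inj_on f S" using finS by (simp add: eq_card_imp_inj_on)
  have perm: "f permutes S"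
  proof (rule bij_imp_permutes)
    show "bij_betw f S S" using injf a'S by (simp add: bij_betw_def)
  qed (simp add: f_def)
  then have permn: "permutation f" using finS by (auto simp: permutation_permutes)
  have B': "{l \<in> I. a' l = f s} = B s" if s: "s \<in> S" for s
  proof -
    have "a' l = f s \<longleftrightarrow> a l = s" if "l \<in> I" for l
      unfolding fa[OF that, symmetric] using that s by (intro inj_on_eq_iff[OF injf]) (auto simp: S_def)
    then show ?thesis by (auto simp: B_def)
  qed
  have FV: "F x \<in> V (f s)" if "s \<in> S" "x \<in> V s" for s x
    using semilin_span[OF F, of x "u ` B s"] that blocks[of "f s"] B'[OF that(1)]
    by (simp add: V_def B_def image_image)
  have fS: "(f ^^ n) s \<in> S" if "s \<in> S" for n s
    using that by (induction n) (use a'S in auto)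
  have FnV: "(F ^^ n) x \<in> V ((f ^^ n) s)" if "s \<in> S" "x \<in> V s" for n x s
    using that by (induction n) (use FV fS in auto)
  have N: "card (B (f s)) = card (B s)" if "s \<in> S" for s
    using cardB[of "f s"] B'[OF that] by simp
  have Nn: "card (B ((f ^^ n) s)) = card (B s)" if "s \<in> S" for n s
    using that by (induction n) (use N fS in auto)
  have injFI: "inj_on F (span (u ` I))"
    using semilin_inj_on[OF F fin w] q by auto
  have VI: "V s \<subseteq> span (u ` I)" for s
    unfolding V_def by (intro span_mono) (auto simp: B_def)
  have injn: "inj_on (F ^^ n) (V s)" if "s \<in> S" for n s
  proof (induction n)
    case (Suc n)
    have "inj_on F ((F ^^ n) ` V s)"
      using FnV[OF that] VI by (intro inj_on_subset[OF injFI]) blast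
    then show ?case using comp_inj_on[OF Suc] by (simp add: comp_def)
  qed auto

  \<comment> \<open>Bases fixed by return maps\<close>
  have "\<exists>b. indep_family {..<card (B t)} b \<and> (\<forall>n<card (B t). b n \<in> V t \<and> (F ^^ m) (b n) = b n)"
    if t: "t \<in> S" and m: "m > 0" "(f ^^ m) t = t" for t m
  proof -
    let ?Fix = "{x \<in> V t. (F ^^ m) x = x}"
    have "q ^ m \<ge> q" using q m by (intro self_le_power) auto
    then have "V t \<subseteq> span ?Fix"
      unfolding V_def
      by (intro lang[OF semilin_funpow[OF F]])
         (use q injn[OF t] FnV[OF t, of _ m] m finB in \<open>auto simp: V_def\<close>)
    obtain X where X: "X \<subseteq> ?Fix" "independent X" "?Fix \<subseteq> span X"
      using maximal_independent_subset by blast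
    have "span X = V t"
    proof
      show "span X \<subseteq> V t" unfolding V_def by (rule span_minimal) (use X(1) in \<open>auto simp: V_def\<close>)
      show "V t \<subseteq> span X" using \<open>V t \<subseteq> span ?Fix\<close> X(3) span_minimal[of ?Fix "span X"] by auto
    qed
    then have "card X = card (B t)"
      using span_eq_dim[of X "u ` B t"] X(2) indep_family_mono[OF u, of "B t"]
      by (auto simp: V_def dim_eq_card_independent indep_family_def card_image B_def)
    moreover have "finite X"
      using independent_span_bound[of "u ` B t" X] X(1,2) finB[of t] by (auto simp: V_def)
    ultimately obtain b where b: "bij_betw b {..<card (B t)} X"
      using ex_bij_betw_nat_finite[of X] by (auto simp: atLeast0LessThan)
    then show ?thesis
      using X(1,2) by (intro exI[of _ b]) (auto simp: bij_betw_def indep_family_def)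
  qed
  then have "\<forall>t m. \<exists>b. t \<in> S \<and> m > 0 \<and> (f ^^ m) t = t \<longrightarrow>
      indep_family {..<card (B t)} b \<and> (\<forall>n<card (B t). b n \<in> V t \<and> (F ^^ m) (b n) = b n)"
    by blast
  then obtain b0 where b0: "\<And>t m. t \<in> S \<Longrightarrow> m > 0 \<Longrightarrow> (f ^^ m) t = t \<Longrightarrow>
      indep_family {..<card (B t)} (b0 t m) \<and> (\<forall>n<card (B t). b0 t m n \<in> V t \<and> (F ^^ m) (b0 t m n) = b0 t m n)"
    by metis
  define m where "m t = (LEAST m. m > 0 \<and> (f ^^ m) t = t)" for t
  have m: "m t > 0" "(f ^^ m t) t = t" for t
  proof -
    have "\<exists>m. m > 0 \<and> (f ^^ m) t = t"
      using permutation_self_in_orbit[OF permn, of t] by (auto simp: orbit_altdef)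
    from LeastI_ex[OF this] show "m t > 0" "(f ^^ m t) t = t" by (auto simp: m_def)
  qed
  have m_least: "m t \<le> n" if "n > 0" "(f ^^ n) t = t" for t n
    unfolding m_def using that by (intro Least_le) auto
  define b where "b t = b0 t (m t)" for t
  have b: "indep_family {..<card (B t)} (b t)" "\<And>n. n < card (B t) \<Longrightarrow> b t n \<in> V t"
    "\<And>n. n < card (B t) \<Longrightarrow> (F ^^ m t) (b t n) = b t n" if "t \<in> S" for t
    using b0[OF that m] by (auto simp: b_def)

  \<comment> \<open>The position of a block in its cycle\<close>
  define rep where "rep s = (SOME t. t \<in> orbit f s)" for s
  have rep_orbit: "rep s \<in> orbit f s" for s
    unfolding rep_def using permutation_self_in_orbit[OF permn] by (rule someI)
  \<comment> \<open>The choice depends on the orbit only as a set, so all blocks of a cycle share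
    one representative.\<close>
  have rep_f: "rep (f s) = rep s" for s
    by (simp add: rep_def permutation_orbit_step[OF permn])
  have repS: "rep s \<in> S" if "s \<in> S" for s
    using permutes_orbit_subset[OF perm that] rep_orbit by auto
  define k where "k s = (LEAST n. (f ^^ n) (rep s) = s)" for s
  have k: "(f ^^ k s) (rep s) = s" for s
  proof -
    have "s \<in> orbit f (rep s)"
      using orbit_swap[OF permutation_self_in_orbit[OF permn] rep_orbit] .
    then obtain n where "s = (f ^^ n) (rep s)" by (auto simp only: orbit_altdef mem_Collect_eq)
    from this[symmetric] have "\<exists>n. (f ^^ n) (rep s) = s" by (rule exI)
    then show ?thesis unfolding k_def by (rule LeastI_ex)
  qed
  have k_le: "k s \<le> n" if "(f ^^ n) (rep s) = s" for s n
    unfolding k_def using that by (rule Least_le)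
  have injf': "inj f" using perm by (rule permutes_inj)
  \<comment> \<open>The position grows by one along the cycle, except on arrival at the
    representative, where it drops to 0 after exactly \<open>m (rep s)\<close> steps; there the
    basis fixed by the return map closes the cycle.\<close>
  have k_f: "(k (f s) = Suc (k s)) \<or> (k (f s) = 0 \<and> Suc (k s) = m (rep s) \<and> f s = rep s)" for s
  proof (cases "f s = rep s")
    case True
    then have "k (f s) = 0" using k_le[of 0 "f s"] rep_f[of s] by simp
    have "m (rep s) \<le> Suc (k s)" using k[of s] True by (intro m_least) auto
    obtain m' where m': "m (rep s) = Suc m'" using m(1)[of "rep s"] by (cases "m (rep s)") auto
    then have "f ((f ^^ m') (rep s)) = f s" using m(2)[of "rep s"] True by simp
    then have "(f ^^ m') (rep s) = s" using injf' by (simp add: inj_eq)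
    then have "k s \<le> m'" by (rule k_le)
    then show ?thesis using True \<open>k (f s) = 0\<close> \<open>m (rep s) \<le> _\<close> m' by simp
  next
    case False
    have "k (f s) \<le> Suc (k s)" using k[of s] by (intro k_le) (simp add: rep_f)
    have "(f ^^ k (f s)) (rep s) = f s" using k[of "f s"] by (simp add: rep_f)
    moreover from this False obtain n where n: "k (f s) = Suc n" by (cases "k (f s)") auto
    ultimately have "(f ^^ n) (rep s) = s" using injf' by (simp add: inj_eq)
    then have "k s \<le> n" by (rule k_le)
    then show ?thesis using n \<open>k (f s) \<le> _\<close> by simp
  qed

  \<comment> \<open>Spreading the fixed bases over the cycles\<close>
  have "\<forall>s. \<exists>h. bij_betw h (B s) {..<card (B s)}"
    using ex_bij_betw_finite_nat[OF finB] by (simp add: atLeast0LessThan)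
  then obtain h where h: "\<And>s. bij_betw (h s) (B s) {..<card (B s)}" by metis
  define \<nu> where "\<nu> i = h (a i) i" for i
  have \<nu>: "bij_betw \<nu> (B s) {..<card (B s)}" for s
    using h[of s] by (subst bij_betw_cong[of _ _ "h s"]) (auto simp: \<nu>_def B_def)
  define v where "v i = (F ^^ k (a i)) (b (rep (a i)) (\<nu> i))" for i
  \<comment> \<open>Blocks of one cycle have equal size and are numbered by \<open>\<nu>\<close>;
    \<open>\<pi>\<close> moves an index to the one with the same number in the next block, so that F
    carries \<open>v\<close> along it.\<close>
  define \<pi> where "\<pi> i = (if i \<in> I then inv_into (B (a' i)) \<nu> (\<nu> i) else i)" for i
  have iB: "i \<in> B (a i)" "a i \<in> S" if "i \<in> I" for i using that by (auto simp: B_def S_def)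
  have \<pi>: "\<pi> i \<in> B (a' i)" "\<nu> (\<pi> i) = \<nu> i" if "i \<in> I" for i
  proof -
    have "\<nu> i \<in> \<nu> ` B (a' i)"
      using \<nu>[of "a i"] \<nu>[of "a' i"] iB[OF that] N[of "a i"] fa[OF that] by (auto simp: bij_betw_def)
    then show "\<pi> i \<in> B (a' i)" "\<nu> (\<pi> i) = \<nu> i"
      using that by (auto simp: \<pi>_def inv_into_into f_inv_into_f)
  qed
  have card_rep: "card (B (rep s)) = card (B s)" if "s \<in> S" for s
    using Nn[OF repS[OF that], of "k s"] k[of s] by simp
  have \<nu>_less: "\<nu> i < card (B (rep (a i)))" if "i \<in> I" for i
    using \<nu>[of "a i"] iB[OF that] card_rep by (auto simp: bij_betw_def)
  show ?thesis
  proof (intro exI[of _ v] exI[of _ \<pi>] conjI ballI)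
    have "inj_on \<pi> I"
    proof (rule inj_onI)
      fix i j assume ij: "i \<in> I" "j \<in> I" "\<pi> i = \<pi> j"
      then have "a' i = a' j" "\<nu> i = \<nu> j" using \<pi>[of i] \<pi>[of j] by (simp_all add: B_def)
      then have "f (a i) = f (a j)" using ij by (simp add: fa)
      then have "a i = a j" using inj_onD[OF injf] iB ij by blast
      then have "i \<in> B (a i)" "j \<in> B (a i)" using ij by (auto simp: B_def)
      then show "i = j" using inj_onD[OF bij_betw_imp_inj_on[OF \<nu>] \<open>\<nu> i = \<nu> j\<close>] by blast
    qed
    moreover have "\<pi> ` I \<subseteq> I" using \<pi> by (auto simp: B_def)
    ultimately have "bij_betw \<pi> I I" using fin by (simp add: bij_betw_def endo_inj_surj)
    then show "\<pi> permutes I" by (rule bij_imp_permutes) (simp add: \<pi>_def)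
    show "a (\<pi> i) = a' i" if "i \<in> I" for i using \<pi>[OF that] by (simp add: B_def)
    show "v (\<pi> i) = F (v i)" if i: "i \<in> I" for i
    proof -
      have "a (\<pi> i) = f (a i)" using \<pi>[OF i] fa[OF i] by (simp add: B_def)
      then have "v (\<pi> i) = (F ^^ k (f (a i))) (b (rep (a i)) (\<nu> i))"
        using \<pi>[OF i] by (simp add: v_def rep_f)
      also have "\<dots> = (F ^^ Suc (k (a i))) (b (rep (a i)) (\<nu> i))"
        using k_f[of "a i"]
      proof
        assume "k (f (a i)) = 0 \<and> Suc (k (a i)) = m (rep (a i)) \<and> f (a i) = rep (a i)"
        then have "k (f (a i)) = 0" "Suc (k (a i)) = m (rep (a i))" by blast+
        then show ?thesis
          using b(3)[OF repS[OF iB(2)[OF i]] \<nu>_less[OF i]] by (simp only: funpow.simps(1) id_apply)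
      qed (simp only:)
      also have "\<dots> = F (v i)" by (simp add: v_def)
      finally show ?thesis .
    qed
    have vV: "v i \<in> V (a i)" if i: "i \<in> I" for i
    proof -
      have "b (rep (a i)) (\<nu> i) \<in> V (rep (a i))"
        by (rule b(2)[OF repS[OF iB(2)[OF i]] \<nu>_less[OF i]])
      from FnV[OF repS[OF iB(2)[OF i]] this, of "k (a i)"] show ?thesis by (simp add: v_def k)
    qed
    then show "v i \<in> span (u ` {l \<in> I. a l = a i})" if "i \<in> I" for i
      using that by (simp add: V_def B_def)
    show "indep_family I v"
    proof (rule indep_family_if_spanning[OF w fin], rule image_subsetI)
      fix i assume i: "i \<in> I"
      define s where "s = f (a i)"
      define t where "t = rep s"
      have sS: "s \<in> S" unfolding s_def using a'S iB(2)[OF i] by blast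
      then have tS: "t \<in> S" by (simp add: t_def repS)
      have kt: "(f ^^ k s) t = s" using k[of s] by (simp add: t_def)
      have "F (u i) \<in> V s"
        using FV[OF iB(2)[OF i], of "u i"] iB(1)[OF i] by (auto simp: s_def V_def intro: span_base)
      have "indep_family {..<card (B t)} (\<lambda>n. (F ^^ k s) (b t n))"
      proof (rule indep_familyI)
        fix c n assume 0: "(\<Sum>n<card (B t). c n *s (F ^^ k s) (b t n)) = 0" and n: "n \<in> {..<card (B t)}"
        have "q ^ k s > 0" using q by simp
        then obtain R :: "'k \<Rightarrow> 'k" where R: "\<And>x. R x ^ (q ^ k s) = x"
          using nth_root_exists by metis
        have "(F ^^ k s) (\<Sum>n<card (B t). R (c n) *s b t n) = 0"
          using 0 by (simp add: semilin_sum[OF semilin_funpow[OF F]] R)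
        also have "\<dots> = (F ^^ k s) 0" by (simp add: semilin_0[OF semilin_funpow[OF F]])
        finally have "(\<Sum>n<card (B t). R (c n) *s b t n) = 0"
          by (rule inj_onD[OF injn[OF tS]]) (use b(2)[OF tS] in \<open>auto simp: V_def span_zero intro!: span_sum span_scale\<close>)
        then have "R (c n) = 0" using indep_familyD[OF b(1)[OF tS] _ _ n] by auto
        then show "c n = 0" using R[of "c n"] zero_power[OF \<open>q ^ k s > 0\<close>, where ?'a = 'k] by metis
      qed auto
      then have "span ((\<lambda>n. (F ^^ k s) (b t n)) ` {..<card (B t)}) = V s"
        unfolding V_def using FnV[OF tS b(2)[OF tS], of _ "k s"] kt finB card_rep[OF sS]
        by (intro indep_family_spans) (auto simp: V_def t_def)
      moreover have "(\<lambda>n. (F ^^ k s) (b t n)) ` {..<card (B t)} = v ` B s"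
      proof -
        have "{..<card (B t)} = \<nu> ` B s" using \<nu>[of s] card_rep[OF sS] by (simp add: bij_betw_def t_def)
        then show ?thesis by (auto simp: image_image v_def t_def B_def)
      qed
      ultimately have "F (u i) \<in> span (v ` B s)" using \<open>F (u i) \<in> V s\<close> by simp
      then show "F (u i) \<in> span (v ` I)" by (rule span_family_mono) (auto simp: B_def)
    qed
  qed
qed

section \<open>The normal form modulo $p$\<close>

locale zip_space = acf_space scale
  for scale :: "'k::{alg_closed_field, field_prime_char} \<Rightarrow> 'v::ab_group_add \<Rightarrow> 'v" (infixr \<open>*s\<close> 75)

text \<open>A semilinear map is a linear map into the space whose scalars are twisted by the p-th
  power. In characteristic p the twist is again a vector space, so linear extension from an
  independent set applies.\<close>

lemma (in zip_space) semilin_extension: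
  assumes "indep_family I u"
  shows "\<exists>F. semilin CHAR('k) F \<and> (\<forall>i\<in>I. F (u i) = w i)"
proof -
  interpret twist: vector_space "\<lambda>c. scale (c ^ CHAR('k))"
    by unfold_locales
       (simp_all add: scale_right_distrib scale_left_distrib freshmans_dream power_mult_distrib)
  interpret pair: vector_space_pair scale "\<lambda>c. scale (c ^ CHAR('k))" ..
  have inj: "inj_on u I" and ind: "independent (u ` I)"
    using assms by (auto simp: indep_family_def)
  obtain F where F: "Vector_Spaces.linear scale (\<lambda>c. scale (c ^ CHAR('k))) F"
    "\<forall>x\<in>u ` I. F x = w (the_inv_into I u x)"
    using pair.linear_independent_extend[OF ind, of "\<lambda>x. w (the_inv_into I u x)"] by blast
  show ?thesis
  proof (intro exI[of _ F] conjI ballI)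
    show "semilin CHAR('k) F"
      using F(1) by (simp add: semilin_def Vector_Spaces.linear_iff)
    show "F (u i) = w i" if "i \<in> I" for i
      using F(2) that by (simp add: the_inv_into_f_f[OF inj])
  qed
qed

text \<open>The normal form of an algebraic zip datum. After a common basis of the two filtrations is
  chosen, \<open>F\<close> relates the blocks \<open>(a, e)\<close>, so that the levels of the neighbouring indices refine
  the blocks; induction on the number of blocks ends when \<open>F\<close> permutes them.\<close>

theorem (in zip_space) zip_normal_form:
  fixes a a' :: "'i \<Rightarrow> int list" and e d :: "'i \<Rightarrow> int"
  assumes fin: "finite I" and "semilin CHAR('k) F" "indep_family I u" "indep_family I (\<lambda>i. F (u i))"
    and "\<And>s. span (u ` {i \<in> I. a i = s}) = span ((\<lambda>i. F (u i)) ` {i \<in> I. a' i = s})"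
    and "\<And>i j. i \<in> I \<Longrightarrow> j \<in> I \<Longrightarrow> a i = a j \<and> e i = e j \<longleftrightarrow> a' i = a' j \<and> d i = d j"
  shows "\<exists>v x \<pi>. \<pi> permutes I \<and> indep_family I v \<and> (\<forall>i\<in>I. a (\<pi> i) = a' i \<and>
    x i \<in> span (u ` eqlev I a e i) \<and> v i - x i \<in> span (u ` higher I a e i) \<and>
    v (\<pi> i) - F (x i) \<in> span ((\<lambda>i. F (u i)) ` higher I a' d i))"
  using assms(2-)
proof (induction "card I - card (a ` I)" arbitrary: a a' e d u F rule: less_induct)
  case less
  let ?p = "CHAR('k)"
  have p: "?p \<ge> 2" "?p > 0" using prime_ge_2_nat[of ?p] by simp_all
  define w where "w = (\<lambda>i. F (u i))"
  have F: "semilin ?p F" and u: "indep_family I u" and w: "indep_family I w"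
    and blocks: "\<And>s. span (u ` {i \<in> I. a i = s}) = span (w ` {i \<in> I. a' i = s})"
    and compat: "\<And>i j. i \<in> I \<Longrightarrow> j \<in> I \<Longrightarrow> a i = a j \<and> e i = e j \<longleftrightarrow> a' i = a' j \<and> d i = d j"
    using less.prems by (simp_all add: w_def)
  show ?case
  proof (cases "\<forall>i\<in>I. \<forall>j\<in>I. a i = a j \<longrightarrow> e i = e j")
    case True
    have "\<exists>v \<pi>. \<pi> permutes I \<and> indep_family I v \<and> (\<forall>i\<in>I.
        v i \<in> span (u ` {l \<in> I. a l = a i}) \<and> v (\<pi> i) = F (v i) \<and> a (\<pi> i) = a' i)"
    proof (rule permuted_blocks_basis[OF F p(1) fin u less.prems(3,4)])
      show "a' i = a' j" if "i \<in> I" "j \<in> I" "a i = a j" for i j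
        using True compat that by blast
    qed
    then obtain v \<pi> where v\<pi>: "\<pi> permutes I" "indep_family I v" and *: "\<forall>i\<in>I.
        v i \<in> span (u ` {l \<in> I. a l = a i}) \<and> v (\<pi> i) = F (v i) \<and> a (\<pi> i) = a' i"
      by (elim exE conjE)
    show ?thesis
    proof (intro exI conjI ballI)
      fix i assume i: "i \<in> I"
      have "eqlev I a e i = {l \<in> I. a l = a i}" using True i unfolding eqlev_def by blast
      then show "v i \<in> span (u ` eqlev I a e i)" using * i by simp
      show "v i - v i \<in> span (u ` higher I a e i)"
        "v (\<pi> i) - F (v i) \<in> span ((\<lambda>i. F (u i)) ` higher I a' d i)"
        using * i by (simp_all add: span_zero)
      show "a (\<pi> i) = a' i" using * i by simp
    qed (rule v\<pi>)+
  next
    case False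

    \<comment> \<open>Refining the blocks by a common basis\<close>
    have "\<exists>t \<omega>. \<omega> permutes I \<and> indep_family I t \<and> (\<forall>i\<in>I. t i \<in> span (u ` atleast I a e i) \<and>
        t (\<omega> i) \<in> span (w ` atleast I a' d i) \<and> a (\<omega> i) = a' i)"
      using blocks by (rule common_adapted_basis[OF fin u w])
    then obtain t \<omega> where \<omega>: "\<omega> permutes I" and t: "indep_family I t" and *: "\<forall>i\<in>I.
        t i \<in> span (u ` atleast I a e i) \<and> t (\<omega> i) \<in> span (w ` atleast I a' d i) \<and> a (\<omega> i) = a' i"
      by (elim exE conjE)
    have tu: "t i \<in> span (u ` atleast I a e i)" and tw: "t (\<omega> i) \<in> span (w ` atleast I a' d i)"
      and a\<omega>: "a (\<omega> i) = a' i" if "i \<in> I" for i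
      using * that by blast+
    have \<omega>I: "\<omega> i \<in> I" if "i \<in> I" for i using \<omega> that by (simp add: permutes_in_image)
    have t\<omega>: "indep_family I (\<lambda>i. t (\<omega> i))"
      using t indep_family_reindex[OF permutes_imp_bij[OF \<omega>]] by blast
    have eqlev_eq: "eqlev I a' d i = eqlev I a e i" if "i \<in> I" for i
      using compat that by (auto simp: eqlev_def)
    have finlev: "finite (eqlev I a e i)" for i using finite_subset[OF lev_subset(1) fin] .
    \<comment> \<open>\<open>y i\<close> is a preimage under F of the leading term of
      \<open>t (\<omega> i)\<close>, and \<open>g i\<close> is the leading term of
      \<open>y i\<close> with respect to \<open>t\<close> instead of \<open>u\<close>. The map F'
      with \<open>g i\<close> sent to \<open>t (\<omega> i)\<close> thus expresses the graded map of
      F in the splitting given by \<open>t\<close>.\<close>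
    have "\<exists>y g. y \<in> span (u ` eqlev I a e i) \<and> g \<in> span (t ` eqlev I a e i) \<and>
        g - y \<in> span (u ` higher I a e i) \<and> t (\<omega> i) - F y \<in> span (w ` higher I a' d i)"
      if i: "i \<in> I" for i
    proof -
      obtain b h where b: "t (\<omega> i) = b + h" "b \<in> span (w ` eqlev I a e i)" "h \<in> span (w ` higher I a' d i)"
        using tw[OF i] unfolding atleast_Un image_Un span_Un eqlev_eq[OF i] by blast
      obtain y where y: "y \<in> span (u ` eqlev I a e i)" "F y = b"
        using semilin_preimage[OF F finlev p(2) b(2)[unfolded w_def]] by blast
      have "y \<in> span (u ` atleast I a e i)" using y(1) by (rule span_family_mono) (rule lev_subset)
      also have "\<dots> = span (t ` atleast I a e i)"
        using tu i by (intro span_atleast_eq(1)[OF fin t, symmetric])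
      finally obtain g h' where g: "y = g + h'" "g \<in> span (t ` eqlev I a e i)" "h' \<in> span (t ` higher I a e i)"
        unfolding atleast_Un image_Un span_Un by blast
      have "span (t ` higher I a e i) = span (u ` higher I a e i)"
        using tu i by (intro span_atleast_eq(2)[OF fin t])
      then have "- h' \<in> span (u ` higher I a e i)" using g(3) by (simp add: span_neg)
      then show ?thesis using y g b by (intro exI[of _ y] exI[of _ g]) simp
    qed
    then obtain y g where y: "\<And>i. i \<in> I \<Longrightarrow> y i \<in> span (u ` eqlev I a e i)"
      and g: "\<And>i. i \<in> I \<Longrightarrow> g i \<in> span (t ` eqlev I a e i)"
      and gy: "\<And>i. i \<in> I \<Longrightarrow> g i - y i \<in> span (u ` higher I a e i)"
      and ty: "\<And>i. i \<in> I \<Longrightarrow> t (\<omega> i) - F (y i) \<in> span (w ` higher I a' d i)"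
      by metis
    have "indep_family I (\<lambda>i. F (y i))"
    proof (rule leading_terms_indep[OF fin w t\<omega>])
      show "F (y i) \<in> span (w ` eqlev I a' d i)" if "i \<in> I" for i
        using semilin_span[OF F y[OF that]] by (simp add: eqlev_eq[OF that] w_def image_image)
      show "t (\<omega> i) - F (y i) \<in> span (w ` higher I a' d i)" if "i \<in> I" for i
        using that by (rule ty)
    qed
    from indep_family_if_semilin_image[OF F fin this p(2)] have yind: "indep_family I y" .
    have gind: "indep_family I g"
    proof (rule triangular_indep[OF fin yind])
      fix i assume i: "i \<in> I"
      have "span (y ` higher I a e i) = span (u ` higher I a e i)"
      proof (rule span_atleast_eq(2)[OF fin yind _ i])
        show "y l \<in> span (u ` atleast I a e l)" if "l \<in> I" for l
          using y[OF that] by (rule span_family_mono) (rule lev_subset)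
      qed
      then show "g i - y i \<in> span (y ` higher I a e i)" using gy[OF i] by simp
    qed
    obtain F' where F': "semilin ?p F'" and F'g: "\<And>i. i \<in> I \<Longrightarrow> F' (g i) = t (\<omega> i)"
      using semilin_extension[OF gind, of "\<lambda>i. t (\<omega> i)"] by blast
    \<comment> \<open>Labels are lists so that a refined label, the old one with the level
      prepended, has the same type. In the refined problem the source level of \<open>i\<close> is
      \<open>e (\<omega> i)\<close>, read off at the neighbouring index, and the target level is
      still \<open>d i\<close>.\<close>
    define a2 where "a2 i = e i # a i" for i
    have eqlev_a2: "{l \<in> I. a2 l = a2 i} = eqlev I a e i" for i
      by (auto simp: a2_def eqlev_def)
    have "\<exists>v x \<pi>. \<pi> permutes I \<and> indep_family I v \<and> (\<forall>i\<in>I. a2 (\<pi> i) = a2 (\<omega> i) \<and>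
        x i \<in> span (g ` eqlev I a2 (\<lambda>i. e (\<omega> i)) i) \<and> v i - x i \<in> span (g ` higher I a2 (\<lambda>i. e (\<omega> i)) i) \<and>
        v (\<pi> i) - F' (x i) \<in> span ((\<lambda>i. F' (g i)) ` higher I (\<lambda>i. a2 (\<omega> i)) d i))"
    proof (rule less.hyps)
      have "a ` I = tl ` a2 ` I" by (simp add: image_image a2_def)
      moreover have "\<not> inj_on tl (a2 ` I)"
      proof
        assume inj: "inj_on tl (a2 ` I)"
        obtain i j where ij: "i \<in> I" "j \<in> I" "a i = a j" "e i \<noteq> e j" using False by blast
        have "tl (a2 i) = tl (a2 j)" using ij by (simp add: a2_def)
        then have "a2 i = a2 j" using inj_onD[OF inj] ij by blast
        then show False using ij by (simp add: a2_def)
      qed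
      ultimately have "card (a ` I) \<noteq> card (a2 ` I)" "card (a ` I) \<le> card (a2 ` I)"
        using eq_card_imp_inj_on[OF finite_imageI[OF fin], of tl a2]
          card_image_le[OF finite_imageI[OF fin], of tl a2] by auto
      moreover have "card (a2 ` I) \<le> card I" using fin by (rule card_image_le)
      ultimately show "card I - card (a2 ` I) < card I - card (a ` I)" by simp
      show "semilin ?p F'" "indep_family I g" by fact+
      show "indep_family I (\<lambda>i. F' (g i))"
        using t\<omega> by (simp add: F'g cong: indep_family_cong)
      show "span (g ` {i \<in> I. a2 i = s}) = span ((\<lambda>i. F' (g i)) ` {i \<in> I. a2 (\<omega> i) = s})" for s
      proof -
        have "span (g ` {i \<in> I. a2 i = s}) = span (t ` {i \<in> I. a2 i = s})"
          using g eqlev_a2 by (intro span_block_eq[OF fin gind]) auto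
        also have "t ` {i \<in> I. a2 i = s} = t ` \<omega> ` {i \<in> I. a2 (\<omega> i) = s}"
          by (subst (1) permutes_image[OF \<omega>, symmetric]) auto
        also have "\<dots> = (\<lambda>i. F' (g i)) ` {i \<in> I. a2 (\<omega> i) = s}"
          by (auto simp: image_image F'g)
        finally show ?thesis .
      qed
      show "a2 i = a2 j \<and> e (\<omega> i) = e (\<omega> j) \<longleftrightarrow> a2 (\<omega> i) = a2 (\<omega> j) \<and> d i = d j"
        if "i \<in> I" "j \<in> I" for i j
        using compat[OF that] that by (auto simp: a2_def a\<omega>)
    qed
    then obtain v x \<pi> where \<pi>: "\<pi> permutes I" and v: "indep_family I v"
      and a2\<pi>: "\<And>i. i \<in> I \<Longrightarrow> a2 (\<pi> i) = a2 (\<omega> i)"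
      and x: "\<And>i. i \<in> I \<Longrightarrow> x i \<in> span (g ` eqlev I a2 (\<lambda>i. e (\<omega> i)) i)"
      and vx: "\<And>i. i \<in> I \<Longrightarrow> v i - x i \<in> span (g ` higher I a2 (\<lambda>i. e (\<omega> i)) i)"
      and v\<pi>: "\<And>i. i \<in> I \<Longrightarrow> v (\<pi> i) - F' (x i) \<in> span ((\<lambda>i. F' (g i)) ` higher I (\<lambda>i. a2 (\<omega> i)) d i)"
      by metis

    \<comment> \<open>Returning from the refined problem\<close>
    have \<pi>I: "\<pi> i \<in> I" if "i \<in> I" for i using \<pi> that by (simp add: permutes_in_image)
    have a\<pi>: "a (\<pi> i) = a (\<omega> i)" "e (\<pi> i) = e (\<omega> i)" if "i \<in> I" for i
      using a2\<pi>[OF that] by (simp_all add: a2_def)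
    have "\<exists>x0. x0 \<in> span (u ` eqlev I a e i) \<and> v i - x0 \<in> span (u ` higher I a e i) \<and>
        F' (v i) - F x0 \<in> span (w ` higher I a' d i)" if i: "i \<in> I" for i
    proof -
      have "x i \<in> span (g ` eqlev I a e i)"
        using x[OF i] by (rule span_family_mono) (auto simp: eqlev_def a2_def)
      moreover have "v i - x i \<in> span (g ` eqlev I a e i)"
        using vx[OF i] by (rule span_family_mono) (auto simp: eqlev_def higher_def a2_def)
      ultimately have "v i \<in> span (g ` eqlev I a e i)" using span_add by fastforce
      then obtain c where c: "v i = (\<Sum>l\<in>eqlev I a e i. c l *s g l)"
        using finlev by (auto elim: span_familyE)
      \<comment> \<open>Exchanging \<open>g\<close> for \<open>y\<close> carries \<open>v i\<close>
        back to the splitting given by \<open>u\<close>, at the cost of terms of higher level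
        only.\<close>
      define x0 where "x0 = (\<Sum>l\<in>eqlev I a e i. c l *s y l)"
      have l: "l \<in> I" "eqlev I a e l = eqlev I a e i" "higher I a e l = higher I a e i"
        "higher I a' d l = higher I a' d i" if "l \<in> eqlev I a e i" for l
        using that lev_mono(3)[of l I a e i] lev_mono(4)[of l I a e i] lev_mono(3)[of l I a' d i]
          eqlev_eq[OF i] by (auto simp: eqlev_def)
      have "x0 \<in> span (u ` eqlev I a e i)"
        unfolding x0_def
      proof (intro span_sum span_scale)
        show "y l \<in> span (u ` eqlev I a e i)" if "l \<in> eqlev I a e i" for l
          using y[OF l(1)[OF that]] l[OF that] by simp
      qed
      moreover have "v i - x0 = (\<Sum>l\<in>eqlev I a e i. c l *s (g l - y l))"
        by (simp add: c x0_def scale_right_diff_distrib sum_subtractf)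
      moreover have "\<dots> \<in> span (u ` higher I a e i)"
      proof (intro span_sum span_scale)
        show "g l - y l \<in> span (u ` higher I a e i)" if "l \<in> eqlev I a e i" for l
          using gy[OF l(1)[OF that]] l[OF that] by simp
      qed
      moreover have "F' (v i) - F x0 = (\<Sum>l\<in>eqlev I a e i. c l ^ ?p *s (t (\<omega> l) - F (y l)))"
        unfolding c x0_def semilin_sum[OF F'] semilin_sum[OF F]
        by (simp add: F'g l(1) scale_right_diff_distrib sum_subtractf)
      moreover have "\<dots> \<in> span (w ` higher I a' d i)"
      proof (intro span_sum span_scale)
        show "t (\<omega> l) - F (y l) \<in> span (w ` higher I a' d i)" if "l \<in> eqlev I a e i" for l
          using ty[OF l(1)[OF that]] l[OF that] by simp
      qed
      ultimately show ?thesis by auto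
    qed
    then obtain x0 where x0: "\<And>i. i \<in> I \<Longrightarrow> x0 i \<in> span (u ` eqlev I a e i)"
      and vx0: "\<And>i. i \<in> I \<Longrightarrow> v i - x0 i \<in> span (u ` higher I a e i)"
      and F'v: "\<And>i. i \<in> I \<Longrightarrow> F' (v i) - F (x0 i) \<in> span (w ` higher I a' d i)"
      by metis
    \<comment> \<open>The recursion compares \<open>v (\<pi> i)\<close> with
      \<open>F' (x i)\<close>, whereas \<open>F (x0 i)\<close> is close to \<open>F' (v i)\<close>.
      The gap \<open>n i\<close> has level above that of \<open>\<pi> i\<close> in the first
      filtration, so adding it to \<open>v (\<pi> i)\<close> leaves the leading term
      unchanged.\<close>
    define n where "n i = F' (v i - x i)" for i
    have n: "n i \<in> span (u ` higher I a e (\<pi> i))" if i: "i \<in> I" for i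
    proof -
      have "n i \<in> span ((\<lambda>i. F' (g i)) ` higher I a2 (\<lambda>i. e (\<omega> i)) i)"
        using semilin_span[OF F' vx[OF i]] by (simp add: n_def image_image)
      then show ?thesis
      proof (rule span_family_trans)
        fix l assume l: "l \<in> higher I a2 (\<lambda>i. e (\<omega> i)) i"
        then have lI: "l \<in> I" and "a2 l = a2 i" "e (\<omega> l) > e (\<omega> i)" by (auto simp: higher_def)
        then have "a' l = a' i" using compat[OF lI i] by (simp add: a2_def)
        then have "atleast I a e (\<omega> l) \<subseteq> higher I a e (\<pi> i)"
          using \<open>e (\<omega> l) > e (\<omega> i)\<close> a\<pi>[OF i] a\<omega>[OF i] a\<omega>[OF lI]
          by (auto simp: atleast_def higher_def)
        then show "F' (g l) \<in> span (u ` higher I a e (\<pi> i))"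
          unfolding F'g[OF lI] using tu[OF \<omega>I[OF lI]] by (rule span_family_mono[rotated])
      qed
    qed
    define v0 where "v0 k = v k + n (inv \<pi> k)" for k
    have v0: "v0 k - v k \<in> span (u ` higher I a e k)" if k: "k \<in> I" for k
      using n[of "inv \<pi> k"] k permutes_inverses(1)[OF \<pi>] permutes_in_image[OF permutes_inv[OF \<pi>]]
      by (simp add: v0_def)
    have "v i \<in> span (u ` atleast I a e i)" if i: "i \<in> I" for i
    proof -
      have "x0 i \<in> span (u ` atleast I a e i)" "v i - x0 i \<in> span (u ` atleast I a e i)"
        using x0[OF i] vx0[OF i] by (auto intro: span_family_mono[OF _ lev_subset(4)] span_family_mono[OF _ lev_subset(5)])
      from span_add[OF this] show ?thesis by simp
    qed
    then have "span (v ` higher I a e i) = span (u ` higher I a e i)" if "i \<in> I" for i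
      using that by (intro span_atleast_eq(2)[OF fin v])
    then have "indep_family I v0"
      using v0 by (intro triangular_indep[OF fin v, of v0 a e]) simp
    moreover have "v0 i - x0 i \<in> span (u ` higher I a e i)" if "i \<in> I" for i
      using span_add[OF v0[OF that] vx0[OF that]] by simp
    moreover have "v0 (\<pi> i) - F (x0 i) \<in> span (w ` higher I a' d i)" if i: "i \<in> I" for i
    proof -
      have "v (\<pi> i) - F' (x i) \<in> span (w ` higher I a' d i)"
        using v\<pi>[OF i]
      proof (rule span_family_trans)
        fix l assume l: "l \<in> higher I (\<lambda>i. a2 (\<omega> i)) d i"
        then have lI: "l \<in> I" and "a' l = a' i" "d l > d i"
          using a\<omega>[OF i] a\<omega>[of l] by (auto simp: higher_def a2_def)
        then have "atleast I a' d l \<subseteq> higher I a' d i" by (auto simp: atleast_def higher_def)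
        then show "F' (g l) \<in> span (w ` higher I a' d i)"
          unfolding F'g[OF lI] using tw[OF lI] by (rule span_family_mono[rotated])
      qed
      from span_add[OF this F'v[OF i]] show ?thesis
        by (simp add: v0_def n_def permutes_inverses(2)[OF \<pi>] semilin_diff[OF F'] algebra_simps)
    qed
    ultimately show ?thesis
      using \<pi> x0 a\<pi> a\<omega>
      by (intro exI[of _ v0] exI[of _ x0] exI[of _ \<pi>] conjI ballI) (simp_all add: w_def)
  qed
qed

text \<open>Three kinds of coefficients are packed into one matrix: those of equal level enter both
  expansions, higher ones only the first, lower ones only the second, stored as p-th roots. A single
  Witt vector per entry can then lift both expansions at once.\<close>

lemma (in zip_space) zip_normal_form_coefficients:
  fixes e :: "'i \<Rightarrow> nat"
  assumes fin: "finite I" and u: "indep_family I u" and w: "indep_family I w"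
    and span: "span (u ` I) = span (w ` I)"
  shows "\<exists>\<beta> v \<pi>. \<pi> permutes I \<and> indep_family I v \<and> (\<forall>i\<in>I.
    v i = (\<Sum>l\<in>I. (if e i \<le> e l then \<beta> i l else 0) *s u l) \<and>
    v (\<pi> i) = (\<Sum>l\<in>I. (if e l \<le> e i then \<beta> i l ^ CHAR('k) else 0) *s w l))"
proof -
  let ?p = "CHAR('k)"
  have p: "?p > 0" by (simp add: prime_gt_0_nat)
  obtain R :: "'k \<Rightarrow> 'k" where R: "\<And>x. R x ^ ?p = x"
    using nth_root_exists[OF p] by metis
  obtain F where F: "semilin ?p F" and Fu: "\<And>i. i \<in> I \<Longrightarrow> F (u i) = w i"
    using semilin_extension[OF u, of w] by blast
  define a :: "'i \<Rightarrow> int list" where "a i = []" for i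
  let ?e = "\<lambda>i. int (e i)" and ?d = "\<lambda>i. - int (e i)"
  have "\<exists>v x \<pi>. \<pi> permutes I \<and> indep_family I v \<and> (\<forall>i\<in>I. a (\<pi> i) = a i \<and>
      x i \<in> span (u ` eqlev I a ?e i) \<and> v i - x i \<in> span (u ` higher I a ?e i) \<and>
      v (\<pi> i) - F (x i) \<in> span ((\<lambda>i. F (u i)) ` higher I a ?d i))"
  proof (rule zip_normal_form[OF fin F u])
    show "indep_family I (\<lambda>i. F (u i))"
      using w indep_family_cong[of I "\<lambda>i. F (u i)" w] Fu by blast
    have "span (u ` I) = span ((\<lambda>i. F (u i)) ` I)"
      unfolding span using Fu by (intro arg_cong[of _ _ span] image_cong) auto
    then show "span (u ` {i \<in> I. a i = s}) = span ((\<lambda>i. F (u i)) ` {i \<in> I. a i = s})" for s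
      by (cases "s = []") (simp_all add: a_def)
  qed (auto simp: a_def)
  then obtain v x \<pi> where v: "\<pi> permutes I" "indep_family I v" and *: "\<forall>i\<in>I. a (\<pi> i) = a i \<and>
      x i \<in> span (u ` eqlev I a ?e i) \<and> v i - x i \<in> span (u ` higher I a ?e i) \<and>
      v (\<pi> i) - F (x i) \<in> span ((\<lambda>i. F (u i)) ` higher I a ?d i)"
    by (elim exE conjE)
  have "\<exists>b. v i = (\<Sum>l\<in>I. (if e i \<le> e l then b l else 0) *s u l) \<and>
      v (\<pi> i) = (\<Sum>l\<in>I. (if e l \<le> e i then b l ^ ?p else 0) *s w l)" if i: "i \<in> I" for i
  proof -
    have lev: "eqlev I a ?e i = {l \<in> I. e l = e i}" "higher I a ?e i = {l \<in> I. e l > e i}"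
      "higher I a ?d i = {l \<in> I. e l < e i}"
      by (auto simp: eqlev_def higher_def a_def)
    have "x i \<in> span (u ` {l \<in> I. e l = e i})" "v i - x i \<in> span (u ` {l \<in> I. e l > e i})"
      "v (\<pi> i) - F (x i) \<in> span ((\<lambda>i. F (u i)) ` {l \<in> I. e l < e i})"
      using * i unfolding lev[symmetric] by blast+
    moreover have "finite {l \<in> I. e l = e i}" "finite {l \<in> I. e l > e i}" "finite {l \<in> I. e l < e i}"
      using fin by auto
    ultimately obtain b1 b2 b3 where b1: "x i = (\<Sum>l | l \<in> I \<and> e l = e i. b1 l *s u l)"
      and b2: "v i - x i = (\<Sum>l | l \<in> I \<and> e l > e i. b2 l *s u l)"
      and b3: "v (\<pi> i) - F (x i) = (\<Sum>l | l \<in> I \<and> e l < e i. b3 l *s F (u l))"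
      by (elim span_familyE)
    define b where "b l = (if e l = e i then b1 l else if e l > e i then b2 l else R (b3 l))" for l
    have ext: "(\<Sum>l | l \<in> I \<and> P l. c l *s z l) = (\<Sum>l\<in>I. (if P l then c l else 0) *s z l)" for P c z
      using fin by (intro sum.mono_neutral_cong_left) auto
    have "v i = (\<Sum>l | l \<in> I \<and> e l = e i. b1 l *s u l) + (\<Sum>l | l \<in> I \<and> e l > e i. b2 l *s u l)"
      unfolding b1[symmetric] b2[symmetric] by simp
    also have "\<dots> = (\<Sum>l\<in>I. (if e i \<le> e l then b l else 0) *s u l)"
      unfolding ext sum.distrib[symmetric]
      by (intro sum.cong) (auto simp: b_def)
    finally have 1: "v i = \<dots>" .
    have Fx: "F (x i) = (\<Sum>l | l \<in> I \<and> e l = e i. b1 l ^ ?p *s w l)"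
      unfolding b1 semilin_sum[OF F] by (intro sum.cong) (auto simp: Fu)
    have b3': "v (\<pi> i) - F (x i) = (\<Sum>l | l \<in> I \<and> e l < e i. b3 l *s w l)"
      unfolding b3 by (intro sum.cong) (auto simp: Fu)
    have "v (\<pi> i) = (\<Sum>l | l \<in> I \<and> e l = e i. b1 l ^ ?p *s w l) + (\<Sum>l | l \<in> I \<and> e l < e i. b3 l *s w l)"
      unfolding Fx[symmetric] b3'[symmetric] by simp
    also have "\<dots> = (\<Sum>l\<in>I. (if e l \<le> e i then b l ^ ?p else 0) *s w l)"
      unfolding ext sum.distrib[symmetric]
      by (intro sum.cong) (auto simp: b_def R)
    finally show ?thesis using 1 by blast
  qed
  then have "\<forall>i\<in>I. \<exists>b. v i = (\<Sum>l\<in>I. (if e i \<le> e l then b l else 0) *s u l) \<and>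
      v (\<pi> i) = (\<Sum>l\<in>I. (if e l \<le> e i then b l ^ ?p else 0) *s w l)"
    by (rule ballI)
  from bchoice[OF this] obtain \<beta> where "\<forall>i\<in>I.
      v i = (\<Sum>l\<in>I. (if e i \<le> e l then \<beta> i l else 0) *s u l) \<and>
      v (\<pi> i) = (\<Sum>l\<in>I. (if e l \<le> e i then \<beta> i l ^ ?p else 0) *s w l)"
    by (elim exE)
  with v show ?thesis by (intro exI conjI)
qed

section \<open>Bases of modules over local rings\<close>

lemma (in module) basis_if_residually_independent:
  assumes fin: "finite I" and z: "indep_family I z" "span (z ` I) = UNIV"
    and local_ring: "\<And>c. p dvd c \<or> c dvd 1" "\<not> p dvd 1"
    and v: "\<And>c i. (\<Sum>i\<in>I. c i *s v i) \<in> range (scale p) \<Longrightarrow> i \<in> I \<Longrightarrow> p dvd c i"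
  shows "indep_family I v" "span (v ` I) = UNIV"
proof -
  have "\<exists>z \<omega>. indep_family I z \<and> span (z ` I) = UNIV \<and> inj_on \<omega> J \<and> (\<forall>j\<in>J. \<omega> j \<in> I \<and> z (\<omega> j) = v j)"
    if "finite J" "J \<subseteq> I" for J
    using that
  proof (induction J rule: finite_induct)
    case empty
    show ?case using z by (intro exI[of _ z]) simp
  next
    case (insert j J)
    have jI: "j \<in> I" and JI: "J \<subseteq> I" using insert.prems by auto
    from insert.IH[OF JI] obtain z \<omega> where z: "indep_family I z" "span (z ` I) = UNIV"
      and inj: "inj_on \<omega> J" and *: "\<forall>j\<in>J. \<omega> j \<in> I \<and> z (\<omega> j) = v j"
      by (elim exE conjE)
    have \<omega>: "\<omega> l \<in> I" "z (\<omega> l) = v l" if "l \<in> J" for l using * that by simp_all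
    obtain c where c: "v j = (\<Sum>i\<in>I. c i *s z i)"
      using z(2) fin span_familyE[of "v j" z I] by auto
    have "\<exists>k\<in>I - \<omega> ` J. c k dvd 1"
    proof (rule ccontr)
      assume "\<not> ?thesis"
      then have "\<forall>k\<in>I - \<omega> ` J. \<exists>q. c k = p * q" using local_ring(1) by (blast elim: dvdE)
      then obtain q where q: "\<And>k. k \<in> I - \<omega> ` J \<Longrightarrow> c k = p * q k" by metis
      define b where "b l = (if l = j then 1 else if l \<in> J then - c (\<omega> l) else 0)" for l
      have "(\<Sum>l\<in>I. b l *s v l) = (\<Sum>l\<in>insert j J. b l *s v l)"
        using fin jI JI by (intro sum.mono_neutral_right) (auto simp: b_def)
      also have "\<dots> = v j + (\<Sum>l\<in>J. b l *s v l)" using insert.hyps by (simp add: b_def)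
      also have "(\<Sum>l\<in>J. b l *s v l) = (\<Sum>l\<in>J. - (c (\<omega> l) *s z (\<omega> l)))"
        using insert.hyps by (intro sum.cong) (auto simp: b_def \<omega>)
      also have "\<dots> = - (\<Sum>i\<in>\<omega> ` J. c i *s z i)"
        by (simp add: sum_negf sum.reindex[OF inj])
      also have "v j = (\<Sum>i\<in>I - \<omega> ` J. c i *s z i) + (\<Sum>i\<in>\<omega> ` J. c i *s z i)"
        unfolding c using fin \<omega>(1) by (intro sum.subset_diff) auto
      also have "(\<Sum>i\<in>I - \<omega> ` J. c i *s z i) = p *s (\<Sum>i\<in>I - \<omega> ` J. q i *s z i)"
        by (simp add: scale_sum_right q)
      finally have "(\<Sum>l\<in>I. b l *s v l) \<in> range (scale p)" by simp
      from v[OF this jI] show False using local_ring(2) by (simp add: b_def)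
    qed
    then obtain k where k: "k \<in> I" "k \<notin> \<omega> ` J" "c k dvd 1" by blast
    show ?case
    proof (intro exI conjI ballI)
      show "indep_family I (z(k := v j))" "span ((z(k := v j)) ` I) = UNIV"
        using family_exchange[OF fin z(1) c k(1,3)] z(2) by simp_all
      show "inj_on (\<omega>(j := k)) (insert j J)"
        using inj k insert.hyps by (auto simp: inj_on_def)
      fix l assume "l \<in> insert j J"
      then show "(\<omega>(j := k)) l \<in> I" "(z(k := v j)) ((\<omega>(j := k)) l) = v l"
        using k \<omega> insert.hyps by auto
    qed
  qed
  from this[OF fin order_refl] obtain z \<omega> where z: "indep_family I z" "span (z ` I) = UNIV"
    and inj: "inj_on \<omega> I" and *: "\<forall>j\<in>I. \<omega> j \<in> I \<and> z (\<omega> j) = v j"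
    by (elim exE conjE)
  have \<omega>: "\<omega> j \<in> I" "z (\<omega> j) = v j" if "j \<in> I" for j using * that by simp_all
  have bij: "bij_betw \<omega> I I" using inj \<omega>(1) fin by (simp add: bij_betw_def endo_inj_surj image_subset_iff)
  show "indep_family I v"
    using z(1) indep_family_reindex[OF bij, of z] indep_family_cong[of I "\<lambda>j. z (\<omega> j)" v] \<omega>(2) by blast
  have "v ` I = z ` \<omega> ` I" using \<omega>(2) by (auto simp: image_image)
  then show "span (v ` I) = UNIV" using z(2) bij by (simp add: bij_betw_def)
qed

lemma (in module) basis_extension:
  assumes fin: "finite I" and v: "indep_family I v" "span (v ` I) = UNIV"
  shows "\<exists>g. module_hom scale scale g \<and> (\<forall>i\<in>I. g (v i) = y i)"
proof -
  have inj: "inj_on v I" and ind: "independent (v ` I)" using v by (auto simp: indep_family_def)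
  define g where "g x = (\<Sum>i\<in>I. representation (v ` I) x (v i) *s y i)" for x
  have "module_hom scale scale g"
    using ind v(2) by (simp add: module_hom_iff module_axioms g_def representation_add
        representation_scale scale_left_distrib sum.distrib scale_sum_right)
  moreover have "g (v i) = y i" if i: "i \<in> I" for i
  proof -
    have "g (v i) = (\<Sum>l\<in>I. (if l = i then 1 else 0) *s y l)"
      unfolding g_def using i inj
      by (intro sum.cong) (auto simp: representation_basis[OF ind] inj_on_eq_iff)
    also have "\<dots> = y i" using fin i by (simp add: if_distrib[of "\<lambda>c. c *s _"] cong: if_cong)
    finally show ?thesis .
  qed
  ultimately show ?thesis by blast
qed

lemma (in module) basis_change:
  assumes fin: "finite I" and v: "indep_family I v" "span (v ` I) = UNIV"
    and y: "indep_family I y" "span (y ` I) = UNIV"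
  shows "\<exists>g. module_hom scale scale g \<and> bij g \<and> (\<forall>i\<in>I. g (v i) = y i)"
proof -
  obtain g where g: "module_hom scale scale g" "\<forall>i\<in>I. g (v i) = y i"
    using basis_extension[OF fin v] by blast
  obtain h where h: "module_hom scale scale h" "\<forall>i\<in>I. h (y i) = v i"
    using basis_extension[OF fin y] by blast
  interpret module_pair scale scale ..
  have "(h \<circ> g) x = id x" for x
    by (rule module_hom_eq_on_span[OF module_hom_compose[OF g(1) h(1)] module_hom_id, of "v ` I"])
       (use g h v in auto)
  moreover have "(g \<circ> h) x = id x" for x
    by (rule module_hom_eq_on_span[OF module_hom_compose[OF h(1) g(1)] module_hom_id, of "y ` I"])
       (use g h y in auto)
  ultimately have "bij g" by (intro o_bij[of h]) (auto simp: fun_eq_iff)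
  with g show ?thesis by blast
qed

section \<open>Lifting the normal form\<close>

lemma sum_fun_apply: "(\<Sum>i\<in>J. f i) x = (\<Sum>i\<in>J. f i x :: 'b::comm_monoid_add)"
  by (induction J rule: infinite_finite_induct) simp_all

theorem theorem3p1:
  fixes scale :: "'k::{alg_closed_field, field_prime_char} witt \<Rightarrow> 'm::ab_group_add \<Rightarrow> 'm"
    and \<phi> :: "'m \<Rightarrow> 'm" and r :: nat and e :: "nat \<Rightarrow> nat"
  assumes "F_crystal scale \<phi>"
    and "F_crystal.hodge_slopes scale \<phi> r e"
  shows "\<exists>g v \<pi> \<phi>\<^sub>\<pi>. g \<in> GL_module scale \<and> cong_mod scale (of_nat CHAR('k)) g id \<and>
    module.basis_family scale {1..r} v \<and> \<pi> permutes {1..r} \<and>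
    frob_semilinear scale \<phi>\<^sub>\<pi> \<and> inj \<phi>\<^sub>\<pi> \<and>
    (\<forall>i\<in>{1..r}. \<phi>\<^sub>\<pi> (v i) = scale (of_nat CHAR('k) ^ e i) (v (\<pi> i))) \<and>
    F_crystal_iso scale \<phi> scale (g \<circ> \<phi>\<^sub>\<pi>)"
proof -
  interpret F_crystal scale \<phi> by fact
  define I where "I = {1..r}"
  have fin: "finite I" by (simp add: I_def)
  define p :: "'k witt" where "p = of_nat CHAR('k)"
  have basis: "basis_family I v \<longleftrightarrow> indep_family I v \<and> span (v ` I) = UNIV" for v
    by (simp add: basis_family_def indep_family_def)
  obtain u w where u: "indep_family I u" "span (u ` I) = UNIV"
    and w: "indep_family I w" "span (w ` I) = UNIV"
    and \<phi>u: "\<And>i. i \<in> I \<Longrightarrow> \<phi> (u i) = scale (p ^ e i) (w i)"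
    using assms(2) unfolding hodge_slopes_def I_def[symmetric] basis p_def[symmetric] by blast
  have \<phi>_add: "\<phi> (x + y) = \<phi> x + \<phi> y" and \<phi>_scale: "\<phi> (scale c x) = scale (witt_frob c) (\<phi> x)" for x y c
    using semilinear by (simp_all add: frob_semilinear_def)
  have "\<phi> 0 = 0" using \<phi>_add[of 0 0] by simp
  then have \<phi>_sum: "\<phi> (\<Sum>i\<in>J. scale (c i) (x i)) = (\<Sum>i\<in>J. scale (witt_frob (c i)) (\<phi> (x i)))" for J :: "nat set" and c x
    by (induction J rule: infinite_finite_induct) (simp_all add: \<phi>_add \<phi>_scale)

  \<comment> \<open>M/pM is realised by functions from \<open>nat\<close> to k: \<open>red\<close>
    takes coordinates with respect to \<open>u\<close>, reduces them and extends by 0 outside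
    \<open>I\<close>; \<open>red_0\<close> identifies its kernel with pM.\<close>
  interpret V: zip_space "\<lambda>(c::'k) f (i::nat). c * f i"
    by unfold_locales (auto simp: fun_eq_iff algebra_simps)

  define red where "red x l = (if l \<in> I then witt_nth (representation (u ` I) x (u l)) 0 else 0)" for x l
  have indu: "independent (u ` I)" and inju: "inj_on u I" using u by (auto simp: indep_family_def)
  have red_add: "red (x + y) = red x + red y" for x y
    using u(2) by (simp add: fun_eq_iff red_def representation_add[OF indu] witt_nth_0_hom)
  have red_scale: "red (scale c x) = (\<lambda>l. witt_nth c 0 * red x l)" for x c
    using u(2) by (simp add: fun_eq_iff red_def representation_scale[OF indu] witt_nth_0_hom)
  have "red 0 = 0" using red_add[of 0 0] by simp
  then have red_sum: "red (\<Sum>i\<in>J. scale (c i) (x i)) = (\<Sum>i\<in>J. (\<lambda>l. witt_nth (c i) 0 * red (x i) l))"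
    for J :: "nat set" and c x
    by (induction J rule: infinite_finite_induct) (simp_all add: red_add red_scale)
  have red_diff: "red (x - y) = red x - red y" for x y
    using red_add[of "x - y" y] by simp
  have rep: "(\<Sum>l\<in>I. scale (representation (u ` I) x (u l)) (u l)) = x" for x
    using sum_representation_eq[OF indu, of x "u ` I"] u(2) fin by (simp add: sum.reindex[OF inju])
  have p_dvd: "p dvd c \<longleftrightarrow> witt_nth c 0 = 0" for c :: "'k witt"
    by (simp add: p_def p_dvd_witt_iff)
  have red_0: "red x = 0 \<longleftrightarrow> x \<in> range (scale p)" for x
  proof
    assume 0: "red x = 0"
    have "p dvd representation (u ` I) x (u l)" if "l \<in> I" for l
      using fun_cong[OF 0, of l] that by (simp add: red_def p_dvd)
    then obtain q where "\<And>l. l \<in> I \<Longrightarrow> representation (u ` I) x (u l) = p * q l"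
      unfolding dvd_def by metis
    then have "x = scale p (\<Sum>l\<in>I. scale (q l) (u l))"
      by (subst rep[symmetric]) (simp add: scale_sum_right)
    then show "x \<in> range (scale p)" by blast
  next
    assume "x \<in> range (scale p)"
    then show "red x = 0" using p_dvd[of p] by (auto simp: red_scale fun_eq_iff)
  qed
  have red_basis: "indep_family I x \<and> span (x ` I) = UNIV" if "V.indep_family I (\<lambda>i. red (x i))" for x
  proof -
    have indep: "p dvd c i" if "(\<Sum>i\<in>I. scale (c i) (x i)) \<in> range (scale p)" "i \<in> I" for c i
    proof -
      have "(\<Sum>i\<in>I. (\<lambda>l. witt_nth (c i) 0 * red (x i) l)) = 0"
        using that(1) by (simp flip: red_sum red_0)
      from V.indep_familyD[OF \<open>V.indep_family I _\<close> fin this that(2)] show ?thesis by (simp add: p_dvd)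
    qed
    have unit: "p dvd c \<or> c dvd 1" for c using witt_unit[of c] by (auto simp: p_dvd)
    have nonunit: "\<not> p dvd 1" by (simp add: p_dvd witt_nth_0_hom)
    note basis_if_residually_independent[OF fin u unit nonunit, of x]
    with indep show ?thesis by blast
  qed
  have red_span: "red x \<in> V.span ((\<lambda>i. red (y i)) ` I)" if y: "span (y ` I) = UNIV" for x y
  proof -
    obtain c where "x = (\<Sum>i\<in>I. scale (c i) (y i))" using y fin span_familyE[of x y I] by auto
    then show ?thesis by (simp only: red_sum V.sum_in_span)
  qed
  have red_u: "red (u i) l = (if l = i then 1 else 0)" if "i \<in> I" for i l
    using that inju by (auto simp: red_def representation_basis[OF indu] witt_nth_0_hom inj_on_eq_iff)
  have ru: "V.indep_family I (\<lambda>i. red (u i))"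
  proof (rule V.indep_familyI[OF fin])
    fix c i assume 0: "(\<Sum>i\<in>I. (\<lambda>l. c i * red (u i) l)) = 0" and i: "i \<in> I"
    have "(\<Sum>j\<in>I. c j * red (u j) i) = c i"
      using fin i by (simp add: red_u if_distrib[of "\<lambda>x. _ * x"] cong: if_cong)
    moreover have "(\<Sum>j\<in>I. c j * red (u j) i) = 0"
      using fun_cong[OF 0, of i] by (simp add: sum_fun_apply)
    ultimately show "c i = 0" by simp
  qed
  have rw: "V.indep_family I (\<lambda>i. red (w i))"
    by (rule V.indep_family_if_spanning[OF ru fin]) (use red_span[OF w(2)] in auto)
  have "V.span ((\<lambda>i. red (u i)) ` I) = V.span ((\<lambda>i. red (w i)) ` I)"
    unfolding V.span_eq using red_span[OF w(2)] red_span[OF u(2)] by auto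
  from V.zip_normal_form_coefficients[OF fin ru rw this, of e]
  obtain \<beta> vb \<pi> where \<pi>: "\<pi> permutes I" and vb: "V.indep_family I vb" and
    *: "\<forall>i\<in>I. vb i = (\<Sum>l\<in>I. (\<lambda>j. (if e i \<le> e l then \<beta> i l else 0) * red (u l) j)) \<and>
      vb (\<pi> i) = (\<Sum>l\<in>I. (\<lambda>j. (if e l \<le> e i then \<beta> i l ^ CHAR('k) else 0) * red (w l) j))"
    by (elim exE conjE)

  \<comment> \<open>Subtraction is truncated, so the power of p is 1 exactly when e_i <= e_l, and in
    \<open>y\<close> exactly when e_l <= e_i. The identity p^(e_i - e_l) p^(e_l) = p^(e_i) p^(e_l -
    e_i), valid in both cases, lets p^(e_i) factor out of the image of \<open>v i\<close> and leaves
    \<open>y i\<close>.\<close>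
  define v where "v i = (\<Sum>l\<in>I. scale (p ^ (e i - e l) * witt_const (\<beta> i l)) (u l))" for i
  define y where "y i = (\<Sum>l\<in>I. scale (p ^ (e l - e i) * witt_frob (witt_const (\<beta> i l))) (w l))" for i
  have p_power_0: "witt_nth (p ^ n * c) 0 = (if n = 0 then witt_nth c 0 else 0)" for n c
    using p_dvd[of p] by (cases n) (simp_all add: witt_nth_0_hom)
  have red_v: "red (v i) = vb i" if "i \<in> I" for i
    unfolding v_def red_sum using * that by (auto simp: p_power_0 intro!: sum.cong)
  have red_y: "red (y i) = vb (\<pi> i)" if "i \<in> I" for i
    unfolding y_def red_sum using * that by (auto simp: p_power_0 intro!: sum.cong)
  have \<phi>v: "\<phi> (v i) = scale (p ^ e i) (y i)" for i
  proof -
    have pp: "p ^ (e i - e l) * p ^ e l = p ^ e i * p ^ (e l - e i)" for l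
      by (cases "e l \<le> e i") (simp_all flip: power_add)
    have "witt_frob (p ^ (e i - e l) * c) * p ^ e l = (p ^ (e i - e l) * p ^ e l) * witt_frob c" for l c
      unfolding p_def witt_frob_p_power_mult by (simp only: mult_ac)
    then have "witt_frob (p ^ (e i - e l) * c) * p ^ e l = p ^ e i * (p ^ (e l - e i) * witt_frob c)" for l c
      by (simp only: pp mult.assoc)
    then show ?thesis
      unfolding v_def y_def \<phi>_sum scale_sum_right by (intro sum.cong) (simp_all add: \<phi>u)
  qed
  have \<pi>I: "\<pi> i \<in> I" if "i \<in> I" for i using \<pi> that by (simp add: permutes_in_image)
  have vb\<pi>: "V.indep_family I (\<lambda>i. vb (\<pi> i))"
    using vb V.indep_family_reindex[OF permutes_imp_bij[OF \<pi>]] by blast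
  have v: "indep_family I v \<and> span (v ` I) = UNIV"
    using vb V.indep_family_cong[of I "\<lambda>i. red (v i)" vb] red_v by (intro red_basis) blast
  have v\<pi>: "indep_family I (\<lambda>i. v (\<pi> i)) \<and> span ((\<lambda>i. v (\<pi> i)) ` I) = UNIV"
    using vb\<pi> V.indep_family_cong[of I "\<lambda>i. red (v (\<pi> i))" "\<lambda>i. vb (\<pi> i)"] red_v \<pi>I
    by (intro red_basis) blast
  have yb: "indep_family I y \<and> span (y ` I) = UNIV"
    using vb\<pi> V.indep_family_cong[of I "\<lambda>i. red (y i)" "\<lambda>i. vb (\<pi> i)"] red_y by (intro red_basis) blast
  obtain g where g: "module_hom scale scale g" "bij g" and gv: "\<And>i. i \<in> I \<Longrightarrow> g (v (\<pi> i)) = y i"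
    using basis_change[OF fin, of "\<lambda>i. v (\<pi> i)" y] v\<pi> yb by blast
  interpret g: module_hom scale scale g by fact
  interpret g': module_hom scale scale "inv g"
    using g module_pair.bij_module_hom_imp_inv_module_hom[OF module_pair.intro] module_axioms by blast
  \<comment> \<open>Defined through \<open>g\<close> rather than on the basis, it inherits
    semilinearity and injectivity from \<open>\<phi>\<close>, and the identity map is the
    isomorphism of crystals.\<close>
  define \<phi>\<pi> where "\<phi>\<pi> = inv g \<circ> \<phi>"
  have comp: "g \<circ> \<phi>\<pi> = \<phi>" using bij_is_surj[OF g(2)] by (auto simp: \<phi>\<pi>_def fun_eq_iff surj_f_inv_f)
  have "g x - x \<in> range (scale p)" for x
  proof -
    obtain c where "x = (\<Sum>i\<in>I. scale (c i) (v (\<pi> i)))"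
      using v\<pi> fin span_familyE[of x "\<lambda>i. v (\<pi> i)" I] by auto
    then have "g x - x = (\<Sum>i\<in>I. scale (c i) (y i - v (\<pi> i)))"
      by (simp add: g.sum g.scale gv scale_right_diff_distrib sum_subtractf)
    moreover have "red (y i - v (\<pi> i)) = 0" if "i \<in> I" for i
      using that by (simp add: red_diff red_y red_v \<pi>I)
    ultimately show ?thesis unfolding red_0[symmetric] by (simp add: red_sum fun_eq_iff sum_fun_apply)
  qed
  moreover have "\<phi>\<pi> (v i) = scale (p ^ e i) (v (\<pi> i))" if "i \<in> I" for i
    using bij_is_inj[OF g(2)] gv[OF that] by (simp add: \<phi>\<pi>_def \<phi>v g'.scale inv_f_eq)
  moreover have "frob_semilinear scale \<phi>\<pi>"
    by (simp add: frob_semilinear_def \<phi>\<pi>_def \<phi>_add \<phi>_scale g'.add g'.scale)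
  moreover have "inj \<phi>\<pi>"
    unfolding \<phi>\<pi>_def using inj bij_is_inj[OF bij_imp_bij_inv[OF g(2)]] by (intro inj_compose)
  moreover have "F_crystal_iso scale \<phi> scale (g \<circ> \<phi>\<pi>)"
    unfolding comp F_crystal_iso_def using assms(1) module_hom_id by (auto intro!: exI[of _ id])
  moreover have "basis_family I v" using v by (simp add: basis)
  ultimately show ?thesis
    using g \<pi> unfolding I_def[symmetric] p_def[symmetric]
    by (intro exI[of _ g] exI[of _ v] exI[of _ \<pi>] exI[of _ \<phi>\<pi>]) (simp add: GL_module_def cong_mod_def)
qed

end
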